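(* Let $\lambda\in\mathbb{C}$ with $|\lambda|=1$ and let $\varphi\sim\sum_{n=-\infty}^\infty a_ne^{in\theta}$ belong to $L^2(\mathbb{T})$. Let $\varphi_{\overline{\lambda},+}\in L^2(\mathbb{T})$ be the function with Fourier series $\varphi_{\overline{\lambda},+}\sim\sum_{n=-\infty}^\infty b_ne^{in\theta}$, where $b_n=\overline{\lambda}^{\,n}a_n$ if $n\ge 0$ and $b_n=a_n$ if $n<0$. 1. The $\lambda$-Toeplitz operator $T_{\lambda,\varphi}$ is bounded if and only if the Toeplitz operator $T_{\varphi_{\overline{\lambda},+}}$ is bounded or, equivalently, $\varphi_{\overline{\lambda},+}\in L^\infty(\mathbb{T})$. Moreover, in this case, $\|T_{\lambda,\varphi}\|=\|\varphi_{\overline{\lambda},+}\|_\infty$. 2. $T_{\lambda,\varphi}$ is compact if and only if $\varphi_{\overline{\lambda},+}\equiv 0$, i.e., if and only if $\varphi\equiv 0$.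
   Context: $\mathbb{T}$ is the unit circle, and $L^2(\mathbb{T})$ has inner product $\langle f,g\rangle=\frac{1}{2\pi}\int_0^{2\pi} f\overline{g}\,d\theta$. The notation $\varphi\sim\sum a_n e^{in\theta}$ means that $(a_n)_{n\in\mathbb{Z}}$ are the Fourier coefficients of $\varphi$. The Hardy space $H^2\subseteq L^2(\mathbb{T})$ is the closed subspace of functions whose Fourier coefficients of negative index vanish, with orthonormal basis $e_n=e^{in\theta}$, $n=0,1,2,\dots$. For $\lambda\in\mathbb{C}$ with $|\lambda|\le 1$, $T_{\lambda,\varphi}$ denotes the operator on $H^2$ given by the matrix $$\langle T_{\lambda,\varphi}e_j,e_i\rangle=\lambda^{\min(i,j)}a_{i-j},\qquad i,j\ge 0,$$ with respect to $(e_n)_{n\ge0}$; it is called bounded (respectively compact) if this matrix is the matrix of a bounded (respectively compact) operator on $H^2$. For $g\in L^2(\mathbb{T})$ with Fourier coefficients $(b_n)_{n\in\mathbb{Z}}$, the Toeplitz operator $T_g$ is the operator on $H^2$ with matrix $(b_{i-j})_{i,j\ge0}$ (i.e. $T_g=T_{1,g}$), with boundedness understood in the same sense; when $g\in L^\infty(\mathbb{T})$ it is $T_gf=P(gf)$, where $P$ is the orthogonal projection of $L^2(\mathbb{T})$ onto $H^2$. *)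

theory Defs
  imports "HOL-Probability.Probability"
begin

text \<open>Elements of \<open>L\<^sup>2(\<T>)\<close> are handled through representatives \<open>complex \<Rightarrow> complex\<close>, of which
  only the values on the unit circle matter; equality in \<open>L\<^sup>2(\<T>)\<close> is equality almost everywhere
  with respect to normalized arc length.\<close>

definition circle :: "complex measure" where
  "circle = distr (uniform_measure lborel {0..2 * pi}) (restrict_space borel (sphere 0 1)) cis"

lemma measurable_cis_sphere: "cis \<in> borel \<rightarrow>\<^sub>M restrict_space borel (sphere 0 1)"
  by (rule measurable_restrict_space2)
     (auto intro!: borel_measurable_continuous_onI continuous_intros)

lemma uniform_measure_circle: "uniform_measure lborel {0..2 * pi} =
    density lborel (\<lambda>x. ennreal (indicator {0..2 * pi} x / (2 * pi)))"
  unfolding uniform_measure_def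
  by (intro arg_cong2[where f=density] refl ext)
     (auto simp: indicator_def divide_ennreal[symmetric] ennreal_1[symmetric] simp del: ennreal_1)

lemma integral_circle:
  fixes f :: "complex \<Rightarrow> complex"
  assumes f: "f \<in> borel_measurable circle"
  shows "integral\<^sup>L circle f = 1 / (2 * pi) * (LINT \<theta>:{0..2 * pi}|lborel. f (cis \<theta>))"
proof -
  have f': "f \<in> borel_measurable (restrict_space borel (sphere 0 1))"
    using f by (simp add: circle_def)
  have m: "(\<lambda>\<theta>. f (cis \<theta>)) \<in> borel_measurable lborel"
    using measurable_compose[OF measurable_cis_sphere f'] by simp
  have "integral\<^sup>L circle f = (LINT \<theta>|uniform_measure lborel {0..2 * pi}. f (cis \<theta>))"
    unfolding circle_def using f' measurable_cis_sphere
    by (intro integral_distr) (auto cong: measurable_cong_sets)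
  also have "\<dots> = (LINT \<theta>|lborel. (indicator {0..2 * pi} \<theta> / (2 * pi)) *\<^sub>R f (cis \<theta>))"
    unfolding uniform_measure_circle using m by (intro integral_density) auto
  also have "\<dots> = (LINT \<theta>|lborel. complex_of_real (1 / (2 * pi)) * (indicator {0..2 * pi} \<theta> *\<^sub>R f (cis \<theta>)))"
    by (intro Bochner_Integration.integral_cong) (auto simp: scaleR_conv_of_real)
  also have "\<dots> = 1 / (2 * pi) * (LINT \<theta>:{0..2 * pi}|lborel. f (cis \<theta>))"
    unfolding set_lebesgue_integral_def by (subst integral_mult_right_zero) simp
  finally show ?thesis .
qed

definition L2 :: "(complex \<Rightarrow> complex) set" where
  "L2 = {f. f \<in> borel_measurable circle \<and> integrable circle (\<lambda>z. (cmod (f z))\<^sup>2)}"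

definition L2_inner :: "(complex \<Rightarrow> complex) \<Rightarrow> (complex \<Rightarrow> complex) \<Rightarrow> complex" where
  "L2_inner f g = (\<integral>z. f z * cnj (g z) \<partial>circle)"

definition L2_norm :: "(complex \<Rightarrow> complex) \<Rightarrow> real" where
  "L2_norm f = sqrt (\<integral>z. (cmod (f z))\<^sup>2 \<partial>circle)"

definition Linf_norm :: "(complex \<Rightarrow> complex) \<Rightarrow> ereal" where
  "Linf_norm f = esssup circle (\<lambda>z. ereal (cmod (f z)))"

definition Linf :: "(complex \<Rightarrow> complex) set" where
  "Linf = {f. f \<in> borel_measurable circle \<and> Linf_norm f < \<infinity>}"

text \<open>On the circle, \<open>fourier_basis n\<close> is \<open>e\<^sup>i\<^sup>\<theta> \<mapsto> e\<^sup>i\<^sup>n\<^sup>\<theta>\<close>.\<close>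

definition fourier_basis :: "int \<Rightarrow> complex \<Rightarrow> complex" where
  "fourier_basis n = (\<lambda>z. z powi n)"

definition fourier_coeff :: "(complex \<Rightarrow> complex) \<Rightarrow> int \<Rightarrow> complex" where
  "fourier_coeff f n = L2_inner f (fourier_basis n)"

definition H2 :: "(complex \<Rightarrow> complex) set" where
  "H2 = {f \<in> L2. \<forall>n<0. fourier_coeff f n = 0}"

text \<open>Linearity is required up to null sets. Together with the norm bound it forces functions that
  agree almost everywhere to have images that agree almost everywhere, so such a map is an operator
  on the space of equivalence classes.\<close>

definition bounded_operator_H2 :: "((complex \<Rightarrow> complex) \<Rightarrow> complex \<Rightarrow> complex) \<Rightarrow> bool" where
  "bounded_operator_H2 A \<longleftrightarrow>
     (\<forall>f\<in>H2. A f \<in> H2) \<and>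
     (\<forall>f\<in>H2. \<forall>g\<in>H2. \<forall>c d. AE z in circle. A (\<lambda>w. c * f w + d * g w) z = c * A f z + d * A g z) \<and>
     (\<exists>C. \<forall>f\<in>H2. L2_norm (A f) \<le> C * L2_norm f)"

text \<open>Compactness in sequential form: bounded sequences are mapped to sequences with a subsequence
  converging in norm.\<close>

definition compact_operator_H2 :: "((complex \<Rightarrow> complex) \<Rightarrow> complex \<Rightarrow> complex) \<Rightarrow> bool" where
  "compact_operator_H2 A \<longleftrightarrow>
     bounded_operator_H2 A \<and>
     (\<forall>f :: nat \<Rightarrow> complex \<Rightarrow> complex.
        (\<forall>n. f n \<in> H2) \<and> (\<exists>B. \<forall>n. L2_norm (f n) \<le> B) \<longrightarrow>
        (\<exists>g\<in>H2. \<exists>r. strict_mono r \<and>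
           (\<lambda>n. L2_norm (\<lambda>z. A (f (r n)) z - g z)) \<longlonglongrightarrow> 0))"

definition op_norm_H2 :: "((complex \<Rightarrow> complex) \<Rightarrow> complex \<Rightarrow> complex) \<Rightarrow> real" where
  "op_norm_H2 A = (SUP f\<in>{f \<in> H2. L2_norm f \<le> 1}. L2_norm (A f))"

definition has_matrix :: "((complex \<Rightarrow> complex) \<Rightarrow> complex \<Rightarrow> complex) \<Rightarrow> (nat \<Rightarrow> nat \<Rightarrow> complex) \<Rightarrow> bool"
  where "has_matrix A m \<longleftrightarrow>
     (\<forall>i j. L2_inner (A (fourier_basis (int j))) (fourier_basis (int i)) = m i j)"

text \<open>Below, operators are given by infinite matrices with respect to \<open>(e\<^sub>n)\<^sub>n\<close>, since a priori a
  matrix need not come from any everywhere defined operator.\<close>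

definition matrix_bounded :: "(nat \<Rightarrow> nat \<Rightarrow> complex) \<Rightarrow> bool" where
  "matrix_bounded m \<longleftrightarrow> (\<exists>A. bounded_operator_H2 A \<and> has_matrix A m)"

definition matrix_compact :: "(nat \<Rightarrow> nat \<Rightarrow> complex) \<Rightarrow> bool" where
  "matrix_compact m \<longleftrightarrow> (\<exists>A. compact_operator_H2 A \<and> has_matrix A m)"

definition lambda_toeplitz :: "complex \<Rightarrow> (complex \<Rightarrow> complex) \<Rightarrow> nat \<Rightarrow> nat \<Rightarrow> complex" where
  "lambda_toeplitz lam \<phi> i j = lam ^ min i j * fourier_coeff \<phi> (int i - int j)"

definition toeplitz :: "(complex \<Rightarrow> complex) \<Rightarrow> nat \<Rightarrow> nat \<Rightarrow> complex" where
  "toeplitz g i j = fourier_coeff g (int i - int j)"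

end

theory Submission
  imports Defs
begin

text \<open>For \<open>|\<lambda>| = 1\<close> the entry \<open>\<lambda>\<^bsup>min(i,j)\<^esup> a\<^bsub>i-j\<^esub>\<close> equals \<open>\<lambda>\<^sup>i b\<^bsub>i-j\<^esub>\<close>, so the \<open>\<lambda>\<close>-Toeplitz matrix is the
  Toeplitz matrix of \<open>\<psi>\<close> followed by a diagonal unitary. If \<open>\<psi>\<close> is bounded, the operator
  sends \<open>f\<close> to the Hardy function whose coefficients are those of \<open>\<psi> f\<close> times \<open>\<lambda>\<^sup>i\<close>, and has norm at
  most the supremum norm of \<open>\<psi>\<close>. Conversely, testing a bounded operator on truncated geometric
  sequences bounds all Fejer means of \<open>\<psi>\<close> by the operator norm \<open>C\<close>; hence \<open>|\<langle>\<psi>, g\<rangle>| \<le> C \<parallel>g\<parallel>\<^sub>1\<close>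
  for all square-integrable \<open>g\<close>, and \<open>|\<psi>| \<le> C\<close> almost everywhere. Finally, a compact operator maps
  the basis to a sequence with a convergent subsequence, so its matrix entries tend to zero
  along a subsequence of each diagonal, where they have constant modulus \<open>|b\<^sub>k|\<close>.\<close>

section \<open>Normalized arc length and the trigonometric system\<close>

lemma prob_space_circle: "prob_space circle"
proof -
  have "prob_space (uniform_measure lborel {0..2 * pi})"
    by (rule prob_space_uniform_measure) auto
  then show ?thesis
    unfolding circle_def
    by (rule prob_space.prob_space_distr) (use measurable_cis_sphere in \<open>simp cong: measurable_cong_sets\<close>)
qed

interpretation circle: prob_space circle
  by (rule prob_space_circle)

lemma space_circle: "space circle = sphere 0 1"
  by (simp add: circle_def space_restrict_space)

lemma sets_circle: "sets circle = sets (restrict_space borel (sphere 0 1))"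
  by (simp add: circle_def)

lemma borel_measurable_circle_continuous:
  "continuous_on (sphere 0 1) f \<Longrightarrow> f \<in> borel_measurable circle"
  for f :: "complex \<Rightarrow> 'b::topological_space"
  using borel_measurable_continuous_on_restrict[of "sphere 0 1" f] sets_circle
  by (simp cong: measurable_cong_sets)

lemma continuous_on_fourier_basis: "continuous_on (sphere 0 1) (fourier_basis n)"
  unfolding fourier_basis_def by (auto intro!: continuous_intros)

lemma measurable_fourier_basis [measurable]: "fourier_basis n \<in> borel_measurable circle"
  by (rule borel_measurable_circle_continuous[OF continuous_on_fourier_basis])

lemma cmod_fourier_basis: "z \<in> space circle \<Longrightarrow> cmod (fourier_basis n z) = 1"
  by (simp add: fourier_basis_def space_circle norm_power_int)

lemma cmod_1_cnj: "cmod z = 1 \<Longrightarrow> cnj z = inverse z"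
  by (rule inverse_unique[symmetric]) (simp add: complex_norm_square[symmetric])

lemma fourier_basis_mult_cnj:
  assumes "z \<in> space circle"
  shows "fourier_basis m z * cnj (fourier_basis n z) = z powi (m - n)"
proof -
  have z: "cmod z = 1" "z \<noteq> 0" using assms by (auto simp: space_circle)
  then show ?thesis
    by (simp add: fourier_basis_def power_int_diff cmod_1_cnj power_int_inverse field_simps)
qed

lemma integral_powi_circle: "(\<integral>z. z powi n \<partial>circle) = (if n = 0 then 1 else 0)"
proof (cases "n = 0")
  case True
  then show ?thesis using circle.prob_space by simp
next
  case False
  \<comment> \<open>An antiderivative of \<open>cis (n * \<theta>)\<close>. It is
    \<open>2 * pi\<close>-periodic, so its increment over a full turn vanishes.\<close>
  define F where "F = (\<lambda>\<theta>::real. cis (n * \<theta>) / (\<i> * n))"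
  have "has_bochner_integral lborel (\<lambda>x. indicator {0..2 * pi} x *\<^sub>R cis (n * x)) (F (2 * pi) - F 0)"
  proof (rule has_bochner_integral_FTC_Icc)
    fix x :: real
    have "((\<lambda>w. exp (\<i> * (n * w)) / (\<i> * n)) has_field_derivative exp (\<i> * (n * complex_of_real x)))
        (at (complex_of_real x))"
      using False by (auto intro!: derivative_eq_intros simp: field_simps)
    from has_vector_derivative_real_field[OF this]
    show "(F has_vector_derivative cis (n * x)) (at x within {0..2 * pi})"
      by (simp add: F_def cis_conv_exp)
    show "continuous_on {0..2 * pi} (\<lambda>x. cis (n * x))"
      by (intro continuous_intros)
  qed auto
  then have "(LINT x:{0..2*pi}|lborel. cis (n * x)) = F (2 * pi) - F 0"
    unfolding set_lebesgue_integral_def by (rule has_bochner_integral_integral_eq)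
  moreover have "F (2 * pi) - F 0 = 0"
    using cis_multiple_2pi[of "of_int n"] by (simp add: F_def ac_simps)
  moreover have "(\<integral>z. z powi n \<partial>circle) = 1 / (2 * pi) * (LINT \<theta>:{0..2 * pi}|lborel. cis \<theta> powi n)"
    using measurable_fourier_basis[of n] by (intro integral_circle) (simp add: fourier_basis_def)
  ultimately show ?thesis using False by (simp add: cis_power_int)
qed

section \<open>Square-integrable functions on the circle\<close>

lemma L2_measurable [measurable_dest]: "f \<in> L2 \<Longrightarrow> f \<in> borel_measurable circle"
  by (simp add: L2_def)

lemma L2_square_integrable: "f \<in> L2 \<Longrightarrow> integrable circle (\<lambda>z. (cmod (f z))\<^sup>2)"
  by (simp add: L2_def)

lemma mult_le_sum_squares: "x * y \<le> x\<^sup>2 + y\<^sup>2" for x y :: real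
  using sum_squares_bound[of x y] zero_le_power2[of x] zero_le_power2[of y] by linarith

lemma L2_integrable_norm_mult:
  assumes "f \<in> L2" "g \<in> L2"
  shows "integrable circle (\<lambda>z. cmod (f z) * cmod (g z))"
proof (rule Bochner_Integration.integrable_bound)
  show "integrable circle (\<lambda>z. (cmod (f z))\<^sup>2 + (cmod (g z))\<^sup>2)"
    using assms by (auto simp: L2_square_integrable)
qed (use assms mult_le_sum_squares in \<open>auto simp: L2_def\<close>)

lemma L2_integrable_mult:
  assumes "f \<in> L2" "g \<in> L2"
  shows "integrable circle (\<lambda>z. f z * g z)"
  by (rule Bochner_Integration.integrable_bound[OF L2_integrable_norm_mult[OF assms]])
     (use assms in \<open>auto simp: L2_def norm_mult\<close>)

lemma L2_cnj: "f \<in> L2 \<Longrightarrow> (\<lambda>z. cnj (f z)) \<in> L2"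
  by (auto simp: L2_def intro: borel_measurable_continuous_on continuous_intros)

lemma L2_integrable_inner:
  "f \<in> L2 \<Longrightarrow> g \<in> L2 \<Longrightarrow> integrable circle (\<lambda>z. f z * cnj (g z))"
  by (intro L2_integrable_mult L2_cnj)

text \<open>The bound is asked for only almost everywhere, so that \<open>M\<close> can later be the
  essential supremum of a symbol.\<close>

lemma L2_mult_bounded:
  assumes "f \<in> borel_measurable circle" "AE z in circle. cmod (f z) \<le> M" "g \<in> L2"
  shows "(\<lambda>z. f z * g z) \<in> L2"
proof -
  have "integrable circle (\<lambda>z. (cmod (f z * g z))\<^sup>2)"
  proof (rule Bochner_Integration.integrable_bound)
    show "integrable circle (\<lambda>z. M\<^sup>2 * (cmod (g z))\<^sup>2)"
      using assms by (auto simp: L2_square_integrable)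
    show "AE z in circle. norm ((cmod (f z * g z))\<^sup>2) \<le> norm (M\<^sup>2 * (cmod (g z))\<^sup>2)"
      using assms(2) by eventually_elim (auto simp: norm_mult power_mult_distrib intro!: mult_right_mono power_mono)
  qed (use assms in \<open>auto simp: L2_def\<close>)
  then show ?thesis using assms by (auto simp: L2_def)
qed

lemma bounded_imp_L2:
  assumes "f \<in> borel_measurable circle" "AE z in circle. cmod (f z) \<le> M"
  shows "f \<in> L2"
  using L2_mult_bounded[OF assms, of "\<lambda>_. 1"] by (simp add: L2_def)

lemma L2_cmult: "f \<in> L2 \<Longrightarrow> (\<lambda>z. c * f z) \<in> L2"
  by (rule L2_mult_bounded[where M = "cmod c"]) auto

lemma L2_add:
  assumes "f \<in> L2" "g \<in> L2"
  shows "(\<lambda>z. f z + g z) \<in> L2"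
proof -
  have "integrable circle (\<lambda>z. (cmod (f z + g z))\<^sup>2)"
  proof (rule Bochner_Integration.integrable_bound)
    show "integrable circle (\<lambda>z. (cmod (f z))\<^sup>2 + 2 * (cmod (f z) * cmod (g z)) + (cmod (g z))\<^sup>2)"
      using assms
      by (intro Bochner_Integration.integrable_add integrable_mult_right L2_square_integrable
            L2_integrable_norm_mult)
    show "AE z in circle. norm ((cmod (f z + g z))\<^sup>2)
        \<le> norm ((cmod (f z))\<^sup>2 + 2 * (cmod (f z) * cmod (g z)) + (cmod (g z))\<^sup>2)"
    proof (rule AE_I2)
      fix z
      have "(cmod (f z + g z))\<^sup>2 \<le> (cmod (f z) + cmod (g z))\<^sup>2"
        by (intro power_mono norm_triangle_ineq) auto
      then show "norm ((cmod (f z + g z))\<^sup>2)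
        \<le> norm ((cmod (f z))\<^sup>2 + 2 * (cmod (f z) * cmod (g z)) + (cmod (g z))\<^sup>2)"
        by (simp add: power2_sum)
    qed
  qed (use assms in \<open>auto simp: L2_def\<close>)
  then show ?thesis using assms by (auto simp: L2_def)
qed

lemma L2_zero: "(\<lambda>z. 0) \<in> L2"
  by (simp add: L2_def)

lemma L2_lincomb: "f \<in> L2 \<Longrightarrow> g \<in> L2 \<Longrightarrow> (\<lambda>z. c * f z + d * g z) \<in> L2"
  by (intro L2_add L2_cmult)

lemma L2_diff: "f \<in> L2 \<Longrightarrow> g \<in> L2 \<Longrightarrow> (\<lambda>z. f z - g z) \<in> L2"
  using L2_lincomb[of f g 1 "-1"] by simp

lemma L2_sum:
  "(\<And>i. i \<in> I \<Longrightarrow> f i \<in> L2) \<Longrightarrow> (\<lambda>z. \<Sum>i\<in>I. a i * f i z) \<in> L2"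
  by (induction I rule: infinite_finite_induct) (auto intro!: L2_add L2_cmult L2_zero)

lemma L2_fourier_basis: "fourier_basis n \<in> L2"
  by (rule bounded_imp_L2[where M = 1]) (auto intro!: AE_I2 simp: cmod_fourier_basis)

lemma L2_integrable: "f \<in> L2 \<Longrightarrow> integrable circle f"
  using L2_integrable_mult[of f "\<lambda>_. 1"] by (simp add: L2_def)

section \<open>Inner product, norm and the Cauchy-Schwarz inequality\<close>

lemma L2_inner_AE_cong:
  assumes "f \<in> L2" "g \<in> L2" "h \<in> L2" "AE z in circle. f z = g z"
  shows "L2_inner f h = L2_inner g h"
  unfolding L2_inner_def using assms
  by (intro integral_cong_AE borel_measurable_integrable L2_integrable_inner) auto

lemma L2_inner_cnj: "L2_inner g f = cnj (L2_inner f g)"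
proof -
  have "L2_inner g f = (\<integral>z. cnj (f z * cnj (g z)) \<partial>circle)"
    by (simp add: L2_inner_def mult.commute)
  then show ?thesis
    unfolding L2_inner_def Bochner_Integration.integral_cnj .
qed

lemma L2_inner_lincomb_left:
  assumes "f \<in> L2" "g \<in> L2" "h \<in> L2"
  shows "L2_inner (\<lambda>z. c * f z + d * g z) h = c * L2_inner f h + d * L2_inner g h"
proof -
  have "L2_inner (\<lambda>z. c * f z + d * g z) h
      = (\<integral>z. c * (f z * cnj (h z)) + d * (g z * cnj (h z)) \<partial>circle)"
    unfolding L2_inner_def by (simp add: algebra_simps)
  also have "\<dots> = c * L2_inner f h + d * L2_inner g h"
    using assms L2_integrable_inner by (simp add: L2_inner_def)
  finally show ?thesis .
qed

lemma L2_inner_diff_left: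
  "f \<in> L2 \<Longrightarrow> g \<in> L2 \<Longrightarrow> h \<in> L2 \<Longrightarrow> L2_inner (\<lambda>z. f z - g z) h = L2_inner f h - L2_inner g h"
  using L2_inner_lincomb_left[of f g h 1 "-1"] by simp

lemma L2_inner_diff_right:
  "f \<in> L2 \<Longrightarrow> g \<in> L2 \<Longrightarrow> h \<in> L2 \<Longrightarrow> L2_inner h (\<lambda>z. f z - g z) = L2_inner h f - L2_inner h g"
  using L2_inner_diff_left[of f g h] by (simp add: L2_inner_cnj[of h])

lemma L2_inner_sum_left:
  assumes "\<And>i. i \<in> I \<Longrightarrow> f i \<in> L2" "h \<in> L2"
  shows "L2_inner (\<lambda>z. \<Sum>i\<in>I. a i * f i z) h = (\<Sum>i\<in>I. a i * L2_inner (f i) h)"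
  using assms(1)
proof (induction I rule: infinite_finite_induct)
  case (insert x F)
  then show ?case
    using L2_inner_lincomb_left[of "f x" "\<lambda>z. \<Sum>i\<in>F. a i * f i z" h "a x" 1] assms(2)
    by (simp add: L2_sum)
qed (auto simp: L2_inner_def)

lemma L2_inner_sum_right:
  assumes "\<And>i. i \<in> I \<Longrightarrow> f i \<in> L2" "h \<in> L2"
  shows "L2_inner h (\<lambda>z. \<Sum>i\<in>I. a i * f i z) = (\<Sum>i\<in>I. cnj (a i) * L2_inner h (f i))"
  by (subst L2_inner_cnj, subst L2_inner_sum_left[OF assms])
     (auto simp: L2_inner_cnj[of h] cnj_sum)

lemma L2_norm_nonneg: "0 \<le> L2_norm f"
  by (simp add: L2_norm_def)

lemma L2_norm_square: "(L2_norm f)\<^sup>2 = (\<integral>z. (cmod (f z))\<^sup>2 \<partial>circle)"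
  by (simp add: L2_norm_def)

lemma L2_inner_self: "L2_inner f f = of_real ((L2_norm f)\<^sup>2)"
proof -
  have "L2_inner f f = (\<integral>z. complex_of_real ((cmod (f z))\<^sup>2) \<partial>circle)"
    unfolding L2_inner_def complex_norm_square ..
  then show ?thesis
    by (simp only: integral_complex_of_real L2_norm_square)
qed

lemma L2_norm_AE_cong:
  assumes "f \<in> L2" "g \<in> L2" "AE z in circle. f z = g z"
  shows "L2_norm f = L2_norm g"
  unfolding L2_norm_def using assms
  by (intro arg_cong[where f = sqrt] integral_cong_AE borel_measurable_integrable L2_square_integrable)
     auto

lemma L2_norm_eq_0_iff: "f \<in> L2 \<Longrightarrow> L2_norm f = 0 \<longleftrightarrow> (AE z in circle. f z = 0)"
  by (simp add: L2_norm_def integral_nonneg_eq_0_iff_AE L2_square_integrable)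

text \<open>With \<open>a\<close>, \<open>b\<close> the norms of \<open>f\<close>, \<open>g\<close>,
  expand the integral of the square of \<open>b * cmod (f z) - a * cmod (g z)\<close>. The form with
  moduli yields the usual inequality, the triangle inequality and the comparison of the 1-norm with
  the 2-norm.\<close>

lemma L2_Cauchy_Schwarz_integral:
  assumes f: "f \<in> L2" and g: "g \<in> L2"
  shows "(\<integral>z. cmod (f z) * cmod (g z) \<partial>circle) \<le> L2_norm f * L2_norm g"
proof (cases "L2_norm f = 0 \<or> L2_norm g = 0")
  case True
  then have "AE z in circle. cmod (f z) * cmod (g z) = 0"
    using f g by (auto simp: L2_norm_eq_0_iff)
  then have "(\<integral>z. cmod (f z) * cmod (g z) \<partial>circle) = 0"
    by (rule integral_eq_zero_AE)
  then show ?thesis by (simp add: L2_norm_nonneg)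
next
  case False
  define a b where "a = L2_norm f" and "b = L2_norm g"
  let ?I = "\<integral>z. cmod (f z) * cmod (g z) \<partial>circle"
  have ab: "0 < a * b"
    using False L2_norm_nonneg[of f] L2_norm_nonneg[of g] by (simp add: a_def b_def)
  have "0 \<le> (\<integral>z. (b * cmod (f z) - a * cmod (g z))\<^sup>2 \<partial>circle)"
    by simp
  also have "\<dots> = (\<integral>z. b\<^sup>2 * (cmod (f z))\<^sup>2 + a\<^sup>2 * (cmod (g z))\<^sup>2
      - 2 * a * b * (cmod (f z) * cmod (g z)) \<partial>circle)"
    by (rule Bochner_Integration.integral_cong) (auto simp: power2_eq_square algebra_simps)
  also have "\<dots> = b\<^sup>2 * a\<^sup>2 + a\<^sup>2 * b\<^sup>2 - 2 * a * b * ?I"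
    using f g by (simp add: L2_square_integrable L2_integrable_norm_mult a_def b_def L2_norm_square)
  finally have "a * b * ?I \<le> a * b * (a * b)"
    by (simp add: power2_eq_square algebra_simps)
  then show ?thesis
    using ab unfolding a_def b_def by (simp only: mult_le_cancel_left_pos)
qed

lemma L2_Cauchy_Schwarz:
  assumes "f \<in> L2" "g \<in> L2"
  shows "cmod (L2_inner f g) \<le> L2_norm f * L2_norm g"
proof -
  have "cmod (L2_inner f g) \<le> (\<integral>z. cmod (f z * cnj (g z)) \<partial>circle)"
    unfolding L2_inner_def by (rule integral_norm_bound)
  also have "\<dots> \<le> L2_norm f * L2_norm g"
    using L2_Cauchy_Schwarz_integral[OF assms] by (simp add: norm_mult)
  finally show ?thesis .
qed

text \<open>Cauchy-Schwarz against the constant 1, which has norm 1 because arc length is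
  normalized.\<close>

lemma L1_le_L2_norm:
  assumes "f \<in> L2"
  shows "(\<integral>z. cmod (f z) \<partial>circle) \<le> L2_norm f"
  using L2_Cauchy_Schwarz_integral[OF assms, of "\<lambda>_. 1"] circle.prob_space
  by (simp add: L2_def L2_norm_def)

lemma L2_norm_triangle:
  assumes f: "f \<in> L2" and g: "g \<in> L2"
  shows "L2_norm (\<lambda>z. f z + g z) \<le> L2_norm f + L2_norm g"
proof (rule power2_le_imp_le)
  have "(L2_norm (\<lambda>z. f z + g z))\<^sup>2
      \<le> (\<integral>z. (cmod (f z))\<^sup>2 + (cmod (g z))\<^sup>2 + 2 * (cmod (f z) * cmod (g z)) \<partial>circle)"
    unfolding L2_norm_square
  proof (rule integral_mono)
    fix z
    have "(cmod (f z + g z))\<^sup>2 \<le> (cmod (f z) + cmod (g z))\<^sup>2"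
      by (intro power_mono norm_triangle_ineq) auto
    then show "(cmod (f z + g z))\<^sup>2 \<le> (cmod (f z))\<^sup>2 + (cmod (g z))\<^sup>2 + 2 * (cmod (f z) * cmod (g z))"
      by (simp add: power2_sum)
  qed (use f g L2_add[OF f g] in
        \<open>auto intro!: Bochner_Integration.integrable_add L2_square_integrable L2_integrable_norm_mult\<close>)
  also have "\<dots> = (L2_norm f)\<^sup>2 + (L2_norm g)\<^sup>2 + 2 * (\<integral>z. cmod (f z) * cmod (g z) \<partial>circle)"
    using f g by (simp add: L2_square_integrable L2_integrable_norm_mult L2_norm_square)
  also have "\<dots> \<le> (L2_norm f + L2_norm g)\<^sup>2"
    using L2_Cauchy_Schwarz_integral[OF f g] by (simp add: power2_sum)
  finally show "(L2_norm (\<lambda>z. f z + g z))\<^sup>2 \<le> (L2_norm f + L2_norm g)\<^sup>2" .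
qed (simp add: L2_norm_nonneg)

lemma L2_norm_mult_bounded:
  assumes "f \<in> borel_measurable circle" "AE z in circle. cmod (f z) \<le> M" "0 \<le> M" "g \<in> L2"
  shows "L2_norm (\<lambda>z. f z * g z) \<le> M * L2_norm g"
proof -
  have "(\<integral>z. (cmod (f z * g z))\<^sup>2 \<partial>circle) \<le> (\<integral>z. M\<^sup>2 * (cmod (g z))\<^sup>2 \<partial>circle)"
  proof (rule integral_mono_AE)
    show "AE z in circle. (cmod (f z * g z))\<^sup>2 \<le> M\<^sup>2 * (cmod (g z))\<^sup>2"
      using assms(2) by eventually_elim (auto simp: norm_mult power_mult_distrib intro!: mult_right_mono power_mono)
  qed (use assms L2_mult_bounded[OF assms(1,2,4)] in \<open>auto simp: L2_square_integrable\<close>)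
  also have "\<dots> = (M * L2_norm g)\<^sup>2"
    by (simp add: power_mult_distrib L2_norm_square)
  finally have "(L2_norm (\<lambda>z. f z * g z))\<^sup>2 \<le> (M * L2_norm g)\<^sup>2"
    by (simp only: L2_norm_square)
  then show ?thesis
    by (rule power2_le_imp_le) (simp add: assms(3) L2_norm_nonneg)
qed

section \<open>Fourier coefficients, trigonometric polynomials and Bessel's inequality\<close>

lemma fourier_coeff_AE_cong:
  "f \<in> L2 \<Longrightarrow> g \<in> L2 \<Longrightarrow> AE z in circle. f z = g z \<Longrightarrow> fourier_coeff f n = fourier_coeff g n"
  unfolding fourier_coeff_def by (rule L2_inner_AE_cong[OF _ _ L2_fourier_basis])

lemma fourier_coeff_lincomb:
  "f \<in> L2 \<Longrightarrow> g \<in> L2 \<Longrightarrow>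
    fourier_coeff (\<lambda>z. c * f z + d * g z) n = c * fourier_coeff f n + d * fourier_coeff g n"
  unfolding fourier_coeff_def by (rule L2_inner_lincomb_left[OF _ _ L2_fourier_basis])

lemma fourier_coeff_diff:
  "f \<in> L2 \<Longrightarrow> g \<in> L2 \<Longrightarrow> fourier_coeff (\<lambda>z. f z - g z) n = fourier_coeff f n - fourier_coeff g n"
  unfolding fourier_coeff_def by (rule L2_inner_diff_left[OF _ _ L2_fourier_basis])

lemma fourier_coeff_basis: "fourier_coeff (fourier_basis m) n = (if m = n then 1 else 0)"
proof -
  have "fourier_coeff (fourier_basis m) n = (\<integral>z. z powi (m - n) \<partial>circle)"
    unfolding fourier_coeff_def L2_inner_def
    by (rule Bochner_Integration.integral_cong) (auto simp: fourier_basis_mult_cnj)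
  then show ?thesis by (simp add: integral_powi_circle)
qed

text \<open>This shift is the source of the Toeplitz structure: the matrix of multiplication by
  \<open>f\<close> depends only on \<open>i - j\<close>.\<close>

lemma fourier_coeff_mult_basis:
  "fourier_coeff (\<lambda>z. f z * fourier_basis j z) i = fourier_coeff f (i - j)"
  unfolding fourier_coeff_def L2_inner_def
proof (rule Bochner_Integration.integral_cong[OF refl])
  fix z assume z: "z \<in> space circle"
  have "fourier_basis j z * cnj (fourier_basis i z) = cnj (fourier_basis (i - j) z)"
    using fourier_basis_mult_cnj[OF z, of j i] fourier_basis_mult_cnj[OF z, of 0 "i - j"]
    by (simp add: fourier_basis_def)
  then show "f z * fourier_basis j z * cnj (fourier_basis i z) = f z * cnj (fourier_basis (i - j) z)"
    by (simp add: mult.assoc)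
qed

lemma L2_norm_fourier_basis: "L2_norm (fourier_basis n) = 1"
proof -
  have "complex_of_real ((L2_norm (fourier_basis n))\<^sup>2) = 1"
    using fourier_coeff_basis[of n n] unfolding fourier_coeff_def L2_inner_self by simp
  then have "(L2_norm (fourier_basis n))\<^sup>2 = 1"
    using of_real_eq_1_iff by blast
  then show ?thesis using L2_norm_nonneg[of "fourier_basis n"] by (simp add: power2_eq_1_iff)
qed

lemma cmod_fourier_coeff_le: "f \<in> L2 \<Longrightarrow> cmod (fourier_coeff f n) \<le> L2_norm f"
  unfolding fourier_coeff_def
  using L2_Cauchy_Schwarz[OF _ L2_fourier_basis, of f n] by (simp add: L2_norm_fourier_basis)

abbreviation trig_poly :: "(int \<Rightarrow> complex) \<Rightarrow> int set \<Rightarrow> complex \<Rightarrow> complex" where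
  "trig_poly a F \<equiv> (\<lambda>z. \<Sum>n\<in>F. a n * fourier_basis n z)"

lemma L2_trig_poly: "trig_poly a F \<in> L2"
  by (intro L2_sum L2_fourier_basis)

lemma fourier_coeff_trig_poly:
  assumes "finite F"
  shows "fourier_coeff (trig_poly a F) n = (if n \<in> F then a n else 0)"
proof -
  have "fourier_coeff (trig_poly a F) n = (\<Sum>m\<in>F. a m * fourier_coeff (fourier_basis m) n)"
    unfolding fourier_coeff_def by (intro L2_inner_sum_left L2_fourier_basis)
  also have "\<dots> = (\<Sum>m\<in>F. if m = n then a m else 0)"
    by (intro sum.cong) (auto simp: fourier_coeff_basis)
  finally show ?thesis using assms by simp
qed

lemma L2_inner_trig_poly_right:
  "f \<in> L2 \<Longrightarrow> L2_inner f (trig_poly a F) = (\<Sum>n\<in>F. cnj (a n) * fourier_coeff f n)"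
  unfolding fourier_coeff_def by (intro L2_inner_sum_right L2_fourier_basis)

text \<open>Expand by orthonormality and complete the square in each coefficient. Taking
  \<open>a\<close> to be the Fourier coefficients gives Bessel and later Parseval; taking
  \<open>f = 0\<close> gives the norm of a trigonometric polynomial.\<close>

lemma L2_norm_diff_trig_poly:
  assumes f: "f \<in> L2" and F: "finite F"
  shows "(L2_norm (\<lambda>z. f z - trig_poly a F z))\<^sup>2
    = (L2_norm f)\<^sup>2 - (\<Sum>n\<in>F. (cmod (fourier_coeff f n))\<^sup>2)
      + (\<Sum>n\<in>F. (cmod (fourier_coeff f n - a n))\<^sup>2)"
proof -
  let ?p = "trig_poly a F" and ?c = "fourier_coeff f"
  note p = L2_trig_poly[of a F]
  have fp: "L2_inner f ?p = (\<Sum>n\<in>F. cnj (a n) * ?c n)"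
    by (rule L2_inner_trig_poly_right[OF f])
  have pp: "L2_inner ?p ?p = (\<Sum>n\<in>F. cnj (a n) * a n)"
    unfolding L2_inner_trig_poly_right[OF p] by (rule sum.cong) (simp_all add: fourier_coeff_trig_poly[OF F])
  have pf: "L2_inner ?p f = (\<Sum>n\<in>F. a n * cnj (?c n))"
    by (subst L2_inner_cnj) (simp add: fp cnj_sum)
  have "complex_of_real ((L2_norm (\<lambda>z. f z - ?p z))\<^sup>2)
      = L2_inner f f - L2_inner f ?p - (L2_inner ?p f - L2_inner ?p ?p)"
    using f p unfolding L2_inner_self[symmetric]
    by (simp add: L2_inner_diff_left L2_inner_diff_right L2_diff)
  \<comment> \<open>Completing the square: the terms in \<open>a n\<close> equal the squared modulus
    of \<open>?c n - a n\<close> minus that of \<open>?c n\<close>.\<close>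
  also have "\<dots> = L2_inner f f - (\<Sum>n\<in>F. ?c n * cnj (?c n))
      + (\<Sum>n\<in>F. (?c n - a n) * cnj (?c n - a n))"
    unfolding fp pp pf sum_subtractf[symmetric] sum.distrib[symmetric] add_diff_eq diff_diff_eq
    by (simp add: sum_subtractf sum.distrib algebra_simps)
  also have "\<dots> = complex_of_real ((L2_norm f)\<^sup>2 - (\<Sum>n\<in>F. (cmod (?c n))\<^sup>2)
      + (\<Sum>n\<in>F. (cmod (?c n - a n))\<^sup>2))"
    unfolding L2_inner_self of_real_add of_real_diff of_real_sum complex_norm_square ..
  finally show ?thesis using of_real_eq_iff by blast
qed

lemma L2_norm_trig_poly:
  assumes "finite F"
  shows "(L2_norm (trig_poly a F))\<^sup>2 = (\<Sum>n\<in>F. (cmod (a n))\<^sup>2)"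
  using L2_norm_diff_trig_poly[OF L2_zero assms, of a]
  by (simp add: fourier_coeff_def L2_inner_def L2_norm_def sum_nonneg)

lemma Bessel:
  assumes "f \<in> L2" "finite F"
  shows "(\<Sum>n\<in>F. (cmod (fourier_coeff f n))\<^sup>2) \<le> (L2_norm f)\<^sup>2"
proof -
  have "0 \<le> (L2_norm (\<lambda>z. f z - trig_poly (fourier_coeff f) F z))\<^sup>2" by simp
  also have "\<dots> = (L2_norm f)\<^sup>2 - (\<Sum>n\<in>F. (cmod (fourier_coeff f n))\<^sup>2)"
    by (subst L2_norm_diff_trig_poly[OF assms]) simp
  finally show ?thesis by simp
qed

section \<open>Uniqueness of Fourier coefficients\<close>

lemma borel_measurable_imp_circle: "f \<in> borel_measurable borel \<Longrightarrow> f \<in> borel_measurable circle"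
  unfolding measurable_cong_sets[OF sets_circle refl] by (rule measurable_restrict_space1)

lemma L2_mult_continuous:
  assumes "f \<in> L2" "continuous_on (sphere 0 1) g"
  shows "(\<lambda>z. f z * g z) \<in> L2"
proof -
  have "bounded (g ` sphere 0 1)"
    using assms(2) by (intro compact_imp_bounded compact_continuous_image) auto
  then obtain M where "\<forall>z\<in>sphere 0 1. cmod (g z) \<le> M"
    by (auto simp: bounded_iff)
  then have "(\<lambda>z. g z * f z) \<in> L2"
    using assms by (intro L2_mult_bounded[where M = M] borel_measurable_circle_continuous AE_I2)
      (auto simp: space_circle)
  then show ?thesis by (simp add: mult.commute)
qed

lemma continuous_on_real_polynomial_function:
  "real_polynomial_function p \<Longrightarrow> continuous_on S (\<lambda>z. complex_of_real (p z))"
  by (intro continuous_on_of_real continuous_at_imp_continuous_on)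
     (auto intro: continuous_real_polymonial_function)

text \<open>A real-linear \<open>h\<close> is a combination of \<open>Re\<close> and
  \<open>Im\<close>, which are combinations of \<open>z\<close> and \<open>cnj z\<close>, and
  \<open>cnj z\<close> is the inverse of \<open>z\<close> on the circle. Such functionals are among
  the generators of the real polynomial functions.\<close>

lemma bounded_linear_circle_eq:
  fixes h :: "complex \<Rightarrow> real"
  assumes "bounded_linear h" "z \<in> space circle"
  shows "complex_of_real (h z)
    = (h 1 - \<i> * h \<i>) / 2 * fourier_basis 1 z + (h 1 + \<i> * h \<i>) / 2 * fourier_basis (-1) z"
proof -
  interpret bounded_linear h by fact
  have "h z = h (Re z *\<^sub>R 1 + Im z *\<^sub>R \<i>)"
    by (rule arg_cong[where f = h]) (auto simp: complex_eq_iff)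
  also have "\<dots> = Re z * h 1 + Im z * h \<i>"
    by (simp only: add scaleR real_scaleR_def)
  finally have hz: "h z = Re z * h 1 + Im z * h \<i>" .
  have "fourier_basis (-1) z = cnj z"
    using assms(2) by (simp add: fourier_basis_def power_int_minus cmod_1_cnj space_circle)
  moreover have "fourier_basis 1 z = z"
    by (simp add: fourier_basis_def)
  ultimately show ?thesis
    unfolding hz by (simp add: complex_eq_iff algebra_simps add_divide_distrib diff_divide_distrib)
qed

text \<open>Multiplication by a coordinate function shifts Fourier coefficients, so the functions with
  vanishing coefficients are stable under multiplication by polynomials in \<open>Re z\<close>, \<open>Im z\<close>; no
  trigonometric form of such polynomials is needed.\<close>

lemma fourier_coeff_mult_real_polynomial_eq_0:
  assumes "real_polynomial_function p" "f \<in> L2" "\<And>n. fourier_coeff f n = 0"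
  shows "fourier_coeff (\<lambda>z. f z * complex_of_real (p z)) n = 0"
  using assms
proof (induction arbitrary: f n rule: real_polynomial_function.induct)
  case (linear h)
  define \<alpha> \<beta> where "\<alpha> = (h 1 - \<i> * h \<i>) / 2" and "\<beta> = (h 1 + \<i> * h \<i>) / 2"
  have L: "(\<lambda>z. f z * fourier_basis m z) \<in> L2" for m
    by (intro L2_mult_continuous linear.prems continuous_on_fourier_basis)
  have "continuous_on (sphere 0 1) (\<lambda>z. complex_of_real (h z))"
    using linear.hyps by (intro continuous_on_real_polynomial_function real_polynomial_function.intros(1))
  then have fh: "(\<lambda>z. f z * complex_of_real (h z)) \<in> L2"
    by (intro L2_mult_continuous linear.prems)
  have "fourier_coeff (\<lambda>z. f z * complex_of_real (h z)) n
      = fourier_coeff (\<lambda>z. \<alpha> * (f z * fourier_basis 1 z) + \<beta> * (f z * fourier_basis (-1) z)) n"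
  proof (rule fourier_coeff_AE_cong[OF fh L2_lincomb[OF L L]], rule AE_I2)
    fix z assume "z \<in> space circle"
    then have "complex_of_real (h z) = \<alpha> * fourier_basis 1 z + \<beta> * fourier_basis (-1) z"
      unfolding \<alpha>_def \<beta>_def by (rule bounded_linear_circle_eq[OF linear.hyps])
    then show "f z * complex_of_real (h z) = \<alpha> * (f z * fourier_basis 1 z) + \<beta> * (f z * fourier_basis (-1) z)"
      by (simp add: distrib_left mult.left_commute)
  qed
  also have "\<dots> = 0"
    by (simp add: fourier_coeff_lincomb L fourier_coeff_mult_basis linear.prems(2) del: mult_minus_left)
  finally show ?case .
next
  case (const c)
  then show ?case
    using fourier_coeff_lincomb[of f f "complex_of_real c" 0 n] by (simp add: mult.commute)
next
  case (add p q)
  have "(\<lambda>z. f z * complex_of_real (r z)) \<in> L2" if "real_polynomial_function r" for r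
    using that add.prems by (intro L2_mult_continuous continuous_on_real_polynomial_function)
  then show ?case
    using fourier_coeff_lincomb[of "\<lambda>z. f z * complex_of_real (p z)" "\<lambda>z. f z * complex_of_real (q z)" 1 1 n]
      add by (simp add: algebra_simps)
next
  case (mult p q)
  have "(\<lambda>z. f z * complex_of_real (p z)) \<in> L2"
    using mult by (intro L2_mult_continuous continuous_on_real_polynomial_function)
  \<comment> \<open>The hypothesis for \<open>q\<close> is applied to the product of
    \<open>f\<close> and \<open>p\<close>; hence the induction generalizes over
    \<open>f\<close>.\<close>
  from mult.IH(2)[OF this mult.IH(1)[OF mult.prems]]
  show ?case by (simp add: mult.assoc)
qed

text \<open>By Stone-Weierstrass \<open>g\<close> is uniformly within \<open>e\<close> of a real
  polynomial \<open>p\<close>. Against \<open>p\<close> the integral is a zeroth Fourier coefficient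
  and vanishes, so what remains is at most \<open>e\<close> times the 1-norm of \<open>f\<close>;
  then \<open>e\<close> tends to 0.\<close>

lemma integral_mult_continuous_eq_0:
  fixes g :: "complex \<Rightarrow> real"
  assumes f: "f \<in> L2" and f0: "\<And>n. fourier_coeff f n = 0" and g: "continuous_on (sphere 0 1) g"
  shows "(\<integral>z. f z * g z \<partial>circle) = 0"
proof -
  have "cmod (\<integral>z. f z * g z \<partial>circle) \<le> e * (\<integral>z. cmod (f z) \<partial>circle)" if e: "e > 0" for e
  proof -
    obtain p where p: "real_polynomial_function p" "\<And>z. z \<in> sphere 0 1 \<Longrightarrow> \<bar>g z - p z\<bar> < e"
      using Stone_Weierstrass_real_polynomial_function[OF compact_sphere g e] by metis
    have L: "(\<lambda>z. f z * complex_of_real (g z)) \<in> L2" "(\<lambda>z. f z * complex_of_real (p z)) \<in> L2"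
      by (intro L2_mult_continuous f continuous_on_of_real g)
         (intro L2_mult_continuous f continuous_on_real_polynomial_function p(1))
    have "(\<integral>z. f z * p z \<partial>circle) = 0"
      using fourier_coeff_mult_real_polynomial_eq_0[OF p(1) f f0, of 0]
      by (simp add: fourier_coeff_def L2_inner_def fourier_basis_def)
    then have "(\<integral>z. f z * g z \<partial>circle) = (\<integral>z. f z * g z - f z * p z \<partial>circle)"
      using L by (simp add: L2_integrable)
    also have "cmod \<dots> \<le> (\<integral>z. cmod (f z * g z - f z * p z) \<partial>circle)"
      by (rule integral_norm_bound)
    also have "\<dots> \<le> (\<integral>z. e * cmod (f z) \<partial>circle)"
    proof (rule integral_mono)
      fix z assume "z \<in> space circle"
      then have "\<bar>g z - p z\<bar> \<le> e" using p(2)[of z] by (simp add: space_circle)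
      then have "\<bar>g z - p z\<bar> * cmod (f z) \<le> e * cmod (f z)"
        by (rule mult_right_mono) simp
      then show "cmod (f z * g z - f z * p z) \<le> e * cmod (f z)"
        by (simp add: norm_mult mult.commute flip: right_diff_distrib of_real_diff)
    qed (intro integrable_norm integrable_mult_right L2_integrable L2_diff L f)+
    finally show ?thesis by simp
  qed
  then have "((\<lambda>e. e * (\<integral>z. cmod (f z) \<partial>circle)) \<longlongrightarrow> 0 * (\<integral>z. cmod (f z) \<partial>circle)) (at_right 0) \<Longrightarrow>
      cmod (\<integral>z. f z * g z \<partial>circle) \<le> 0"
    by (intro tendsto_lowerbound[where F = "at_right 0"]) (auto simp: eventually_at_filter)
  moreover have "((\<lambda>e. e * (\<integral>z. cmod (f z) \<partial>circle)) \<longlongrightarrow> 0 * (\<integral>z. cmod (f z) \<partial>circle)) (at_right 0)"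
    by (intro tendsto_intros)
  ultimately show ?thesis by simp
qed

text \<open>The indicator of a nonempty closed set is the pointwise limit of the continuous
  functions \<open>g n\<close>, cut off linearly at distance \<open>1/n\<close>; dominated
  convergence applies with majorant \<open>cmod (f z)\<close>.\<close>

lemma set_integral_closed_eq_0:
  assumes f: "f \<in> L2" and f0: "\<And>n. fourier_coeff f n = 0" and C: "closed C"
  shows "(LINT z:C \<inter> sphere 0 1|circle. f z) = 0"
\<comment> \<open>The empty set is separate because \<open>infdist\<close> to it is 0 by convention,
  which would make every \<open>g n\<close> constantly 1.\<close>
proof (cases "C = {}")
  case True
  then show ?thesis by (simp add: set_lebesgue_integral_def)
next
  case False
  define g where "g = (\<lambda>n z. max 0 (1 - real n * infdist z C))"
  have lim: "(\<lambda>n. g n z) \<longlonglongrightarrow> indicator C z" for z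
  proof (cases "z \<in> C")
    case True
    then show ?thesis by (simp add: g_def)
  next
    case z: False
    then have pos: "infdist z C > 0"
      using C False in_closed_iff_infdist_zero[of C z] infdist_nonneg[of z C] by simp
    obtain N :: nat where N: "1 / infdist z C < N"
      using reals_Archimedean2 by blast
    have "g n z = 0" if "n \<ge> N" for n
    proof -
      have "1 / infdist z C \<le> n" using N that by linarith
      then have "1 \<le> n * infdist z C" using pos by (simp add: field_simps)
      then show ?thesis by (simp add: g_def)
    qed
    then have "(\<lambda>n. g n z) \<longlonglongrightarrow> 0"
      by (intro tendsto_eventually) (auto simp: eventually_sequentially)
    then show ?thesis using z by simp
  qed
  have cont: "continuous_on (sphere 0 1) (g n)" for n
    unfolding g_def by (intro continuous_intros)
  have "(\<lambda>n. \<integral>z. f z * g n z \<partial>circle) \<longlonglongrightarrow> (\<integral>z. f z * indicator C z \<partial>circle)"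
  proof (rule integral_dominated_convergence[where w = "\<lambda>z. cmod (f z)"])
    show "AE z in circle. (\<lambda>n. f z * g n z) \<longlonglongrightarrow> f z * indicator C z"
      using tendsto_mult[OF tendsto_const tendsto_of_real[OF lim]]
      by (auto intro!: AE_I2 simp: of_real_indicator)
    show "AE z in circle. cmod (f z * g n z) \<le> cmod (f z)" for n
      by (rule AE_I2) (auto simp: norm_mult g_def infdist_nonneg intro!: mult_left_le)
    have "(indicator C :: complex \<Rightarrow> complex) \<in> borel_measurable circle"
      by (intro borel_measurable_imp_circle borel_measurable_indicator borel_closed C)
    then show "(\<lambda>z. f z * indicator C z) \<in> borel_measurable circle"
      by (rule borel_measurable_times[OF L2_measurable[OF f]])
    show "(\<lambda>z. f z * complex_of_real (g n z)) \<in> borel_measurable circle" for n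
      using f borel_measurable_circle_continuous[OF cont[of n]] by (auto simp: L2_def)
  qed (use f in \<open>auto simp: L2_integrable\<close>)
  then have "(\<integral>z. f z * indicator C z \<partial>circle) = 0"
    unfolding integral_mult_continuous_eq_0[OF f f0 cont] by (simp add: LIMSEQ_const_iff)
  moreover have "(LINT z:C \<inter> sphere 0 1|circle. f z) = (\<integral>z. f z * indicator C z \<partial>circle)"
    unfolding set_lebesgue_integral_def
    by (rule Bochner_Integration.integral_cong) (auto simp: indicator_def space_circle)
  ultimately show ?thesis by simp
qed

text \<open>Closed sets form an intersection-stable generator of the Borel sets, so the vanishing of
  the set integrals extends to all measurable sets by a Dynkin argument. A function with vanishing
  integral over every measurable set is zero almost everywhere.\<close>

lemma fourier_coeff_eq_0_imp_AE_eq_0: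
  assumes f: "f \<in> L2" and f0: "\<And>n. fourier_coeff f n = 0"
  shows "AE z in circle. f z = 0"
proof (rule circle.density_zero)
  show int: "integrable circle f" using f by (rule L2_integrable)
  have si: "set_integrable circle B f" if "B \<in> sets circle" for B
    using that int by (simp add: set_integrable_def integrable_mult_indicator)
  have sets: "A \<inter> sphere 0 1 \<in> sets circle" if "A \<in> sets borel" for A :: "complex set"
    using that by (auto simp: sets_circle sets_restrict_space)
  have P: "(LINT z:A \<inter> sphere 0 1|circle. f z) = 0" if "A \<in> sets borel" for A
  proof -
    have "Int_stable (Collect closed :: complex set set)"
      by (auto simp: Int_stable_def)
    moreover have "Collect closed \<subseteq> Pow (UNIV :: complex set)"
      by simp
    moreover have "A \<in> sigma_sets UNIV (Collect closed)"
      using that by (simp add: borel_eq_closed)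
    ultimately show ?thesis
    proof (induction rule: sigma_sets_induct_disjoint)
      case (basic A)
      then show ?case using set_integral_closed_eq_0[OF f f0] by simp
    next
      case empty
      then show ?case by (simp add: set_lebesgue_integral_def)
    next
      case (compl A)
      then have A: "A \<in> sets borel" by (simp add: borel_eq_closed)
      have eq: "A \<inter> sphere 0 1 \<union> (UNIV - A) \<inter> sphere 0 1 = sphere 0 1" by auto
      \<comment> \<open>The total integral vanishes since the whole plane is closed; complements
        follow by subtraction.\<close>
      have "(LINT z:UNIV \<inter> sphere 0 1|circle. f z) = 0"
        by (rule set_integral_closed_eq_0[OF f f0]) simp
      moreover have "(LINT z:A \<inter> sphere 0 1 \<union> (UNIV - A) \<inter> sphere 0 1|circle. f z)
          = (LINT z:A \<inter> sphere 0 1|circle. f z) + (LINT z:(UNIV - A) \<inter> sphere 0 1|circle. f z)"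
        using A by (intro set_integral_Un si sets) auto
      ultimately show ?case using compl.IH unfolding eq by simp
    next
      case (union A)
      then have A: "A i \<in> sets borel" for i by (auto simp: borel_eq_closed)
      have "(LINT z:(\<Union>i. A i \<inter> sphere 0 1)|circle. f z) = (\<Sum>i. LINT z:A i \<inter> sphere 0 1|circle. f z)"
      proof (intro lebesgue_integral_countable_add si sets A)
        show "(\<Union>i. A i \<inter> sphere 0 1) \<in> sets circle"
          by (intro sets.countable_UN image_subsetI sets A)
      qed (use union.hyps(1) in \<open>auto simp: disjoint_family_on_def\<close>)
      then show ?case using union.IH by simp
    qed
  qed
  fix B assume "B \<in> sets circle"
  then obtain A where "A \<in> sets borel" "B = A \<inter> sphere 0 1"
    by (auto simp: sets_circle sets_restrict_space)
  then show "(LINT z:B|circle. f z) = 0" using P by simp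
qed

corollary fourier_coeff_eq_imp_AE_eq:
  assumes "f \<in> L2" "g \<in> L2" "\<And>n. fourier_coeff f n = fourier_coeff g n"
  shows "AE z in circle. f z = g z"
  using fourier_coeff_eq_0_imp_AE_eq_0[OF L2_diff[OF assms(1,2)]] assms
  by (simp add: fourier_coeff_diff)

lemma AE_eq_0_iff_fourier_coeff:
  assumes "f \<in> L2"
  shows "(AE z in circle. f z = 0) \<longleftrightarrow> (\<forall>n. fourier_coeff f n = 0)"
proof
  assume "AE z in circle. f z = 0"
  then show "\<forall>n. fourier_coeff f n = 0"
    using fourier_coeff_AE_cong[OF assms L2_zero] by (simp add: fourier_coeff_def L2_inner_def)
qed (use fourier_coeff_eq_0_imp_AE_eq_0[OF assms] in simp)

section \<open>Completeness and Parseval's identity\<close>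

lemma L2_norm_triangle_diff:
  assumes "f \<in> L2" "g \<in> L2" "h \<in> L2"
  shows "L2_norm (\<lambda>z. f z - h z) \<le> L2_norm (\<lambda>z. f z - g z) + L2_norm (\<lambda>z. g z - h z)"
  using L2_norm_triangle[OF L2_diff[OF assms(1,2)] L2_diff[OF assms(2,3)]] by simp

lemma L2_norm_minus_commute: "L2_norm (\<lambda>z. f z - g z) = L2_norm (\<lambda>z. g z - f z)"
  by (simp add: L2_norm_def norm_minus_commute)

lemma L2_nn_integral: "f \<in> L2 \<Longrightarrow> (\<integral>\<^sup>+z. ennreal ((cmod (f z))\<^sup>2) \<partial>circle) = ennreal ((L2_norm f)\<^sup>2)"
  unfolding L2_norm_square by (rule nn_integral_eq_integral) (auto simp: L2_square_integrable)

text \<open>The increments are summable in the 1-norm, so the telescoping series converges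
  absolutely almost everywhere; Fatou's lemma then turns the pointwise limit into a norm
  estimate.\<close>

lemma L2_complete_geometric:
  assumes p: "\<And>k. p k \<in> L2" and d: "\<And>k. L2_norm (\<lambda>z. p (Suc k) z - p k z) \<le> (1/2) ^ k"
  obtains f where "f \<in> L2" "\<And>k. L2_norm (\<lambda>z. f z - p k z) \<le> 2 * (1/2) ^ k"
proof -
  note [measurable] = L2_measurable[OF p]
  have dL: "(\<lambda>z. p (Suc k) z - p k z) \<in> L2" for k
    using p by (intro L2_diff)
  have "(\<integral>\<^sup>+z. (\<Sum>k. ennreal (cmod (p (Suc k) z - p k z))) \<partial>circle)
      = (\<Sum>k. \<integral>\<^sup>+z. ennreal (cmod (p (Suc k) z - p k z)) \<partial>circle)"
    by (rule nn_integral_suminf) measurable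
  also have "\<dots> \<le> (\<Sum>k. ennreal ((1/2) ^ k))"
  proof (rule suminf_le)
    fix k
    have "(\<integral>z. cmod (p (Suc k) z - p k z) \<partial>circle) \<le> (1/2) ^ k"
      using L1_le_L2_norm[OF dL] d order_trans by blast
    then show "(\<integral>\<^sup>+z. ennreal (cmod (p (Suc k) z - p k z)) \<partial>circle) \<le> ennreal ((1/2) ^ k)"
      by (subst nn_integral_eq_integral) (auto intro: integrable_norm L2_integrable[OF dL] ennreal_leI)
  qed auto
  also have "\<dots> < \<infinity>"
    unfolding infinity_ennreal_def less_top[symmetric]
    by (intro ennreal_suminf_neq_top summable_geometric) auto
  finally have "AE z in circle. (\<Sum>k. ennreal (cmod (p (Suc k) z - p k z))) \<noteq> \<infinity>"
    by (intro nn_integral_PInf_AE) auto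
  then have lim: "AE z in circle. (\<lambda>k. p k z) \<longlonglongrightarrow> lim (\<lambda>k. p k z)"
  proof eventually_elim
    case (elim z)
    then have "summable (\<lambda>k. cmod (p (Suc k) z - p k z))"
      by (intro summable_suminf_not_top) auto
    then have "summable (\<lambda>k. p (Suc k) z - p k z)"
      by (rule summable_norm_cancel)
    then have "convergent (\<lambda>n. \<Sum>k<n. p (Suc k) z - p k z)"
      by (simp add: summable_iff_convergent)
    then have "convergent (\<lambda>n. p n z - p 0 z)"
      using sum_lessThan_telescope[of "\<lambda>k. p k z"] by simp
    then show ?case
      by (simp add: convergent_diff_const_right_iff convergent_LIMSEQ_iff)
  qed
  \<comment> \<open>The unspecified value of \<open>lim\<close> at points of divergence is harmless:
    they form a null set.\<close>
  define f where "f = (\<lambda>z. lim (\<lambda>k. p k z))"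
  have f_meas [measurable]: "f \<in> borel_measurable circle"
    unfolding f_def by measurable
  \<comment> \<open>The right-hand side is the exact geometric sum of \<open>(1/2) ^ (k + i)\<close>
    over \<open>i < j\<close>, which lets the induction on \<open>j\<close> close.\<close>
  have dist: "L2_norm (\<lambda>z. p (k + j) z - p k z) \<le> 2 * (1/2) ^ k * (1 - (1/2) ^ j)" for k j
  proof (induction j)
    case (Suc j)
    have "L2_norm (\<lambda>z. p (k + Suc j) z - p k z)
        \<le> (1/2) ^ (k + j) + L2_norm (\<lambda>z. p (k + j) z - p k z)"
      using L2_norm_triangle_diff[OF p[of "k + Suc j"] p[of "k + j"] p[of k]] d[of "k + j"] by simp
    also have "\<dots> \<le> (1/2) ^ (k + j) + 2 * (1/2) ^ k * (1 - (1/2) ^ j)"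
      using Suc.IH by simp
    also have "\<dots> = 2 * (1/2) ^ k * (1 - (1/2) ^ Suc j)"
      by (simp add: power_add algebra_simps)
    finally show ?case .
  qed (simp add: L2_norm_def)
  have nn: "(\<integral>\<^sup>+z. ennreal ((cmod (f z - p k z))\<^sup>2) \<partial>circle) \<le> ennreal ((2 * (1/2) ^ k)\<^sup>2)" for k
  proof -
    have "(\<integral>\<^sup>+z. ennreal ((cmod (f z - p k z))\<^sup>2) \<partial>circle)
        = (\<integral>\<^sup>+z. liminf (\<lambda>j. ennreal ((cmod (p (k + j) z - p k z))\<^sup>2)) \<partial>circle)"
    proof (rule nn_integral_cong_AE)
      show "AE z in circle. ennreal ((cmod (f z - p k z))\<^sup>2)
          = liminf (\<lambda>j. ennreal ((cmod (p (k + j) z - p k z))\<^sup>2))"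
        using lim
      proof eventually_elim
        case (elim z)
        then have "(\<lambda>j. p (k + j) z) \<longlonglongrightarrow> f z"
          unfolding f_def using LIMSEQ_ignore_initial_segment[of _ _ k] by (simp add: add.commute)
        then have "(\<lambda>j. ennreal ((cmod (p (k + j) z - p k z))\<^sup>2))
            \<longlonglongrightarrow> ennreal ((cmod (f z - p k z))\<^sup>2)"
          by (intro tendsto_intros tendsto_ennrealI)
        then show ?case
          by (rule lim_imp_Liminf[OF trivial_limit_sequentially, symmetric])
      qed
    qed
    \<comment> \<open>Fatou's lemma.\<close>
    also have "\<dots> \<le> liminf (\<lambda>j. \<integral>\<^sup>+z. ennreal ((cmod (p (k + j) z - p k z))\<^sup>2) \<partial>circle)"
      by (intro nn_integral_liminf) measurable
    also have "\<dots> \<le> liminf (\<lambda>j::nat. ennreal ((2 * (1/2) ^ k)\<^sup>2))"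
    proof (intro Liminf_mono always_eventually allI)
      fix j
      have "L2_norm (\<lambda>z. p (k + j) z - p k z) \<le> 2 * (1/2) ^ k"
        by (rule order_trans[OF dist]) (auto intro!: mult_left_le)
      then have "(L2_norm (\<lambda>z. p (k + j) z - p k z))\<^sup>2 \<le> (2 * (1/2) ^ k)\<^sup>2"
        by (rule power_mono) (rule L2_norm_nonneg)
      then show "(\<integral>\<^sup>+z. ennreal ((cmod (p (k + j) z - p k z))\<^sup>2) \<partial>circle) \<le> ennreal ((2 * (1/2) ^ k)\<^sup>2)"
        unfolding L2_nn_integral[OF L2_diff[OF p p]] by (rule ennreal_leI)
    qed
    also have "\<dots> = ennreal ((2 * (1/2) ^ k)\<^sup>2)"
      by (simp add: Liminf_const)
    finally show ?thesis .
  qed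
  have fp: "(\<lambda>z. f z - p k z) \<in> L2" for k
    unfolding L2_def using nn[of k]
    by (auto simp: integrable_iff_bounded intro: le_less_trans)
  have "f \<in> L2"
    using L2_add[OF fp[of 0] p[of 0]] by simp
  moreover have "L2_norm (\<lambda>z. f z - p k z) \<le> 2 * (1/2) ^ k" for k
    using nn[of k] unfolding L2_nn_integral[OF fp] ennreal_le_iff[OF zero_le_power2]
    by (rule power2_le_imp_le) simp
  ultimately show ?thesis using that by blast
qed

text \<open>A subsequence with geometrically small increments converges by the previous lemma, and a
  Cauchy sequence follows its subsequence.\<close>

lemma L2_complete:
  assumes p: "\<And>k. p k \<in> L2"
    and Cauchy: "\<And>e. e > 0 \<Longrightarrow> \<exists>N. \<forall>m\<ge>N. \<forall>n\<ge>N. L2_norm (\<lambda>z. p m z - p n z) < e"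
  obtains f where "f \<in> L2" "(\<lambda>n. L2_norm (\<lambda>z. p n z - f z)) \<longlonglongrightarrow> 0"
proof -
  have "\<exists>N. \<forall>m\<ge>N. \<forall>n\<ge>N. L2_norm (\<lambda>z. p m z - p n z) < (1/2) ^ k" for k :: nat
    by (rule Cauchy) simp
  then obtain N where N: "\<And>k m n. m \<ge> N k \<Longrightarrow> n \<ge> N k \<Longrightarrow> L2_norm (\<lambda>z. p m z - p n z) < (1/2) ^ k"
    by metis
  \<comment> \<open>Partial sums make the indices monotone while dominating \<open>N k\<close>, so
    both \<open>r k\<close> and \<open>r (Suc k)\<close> lie beyond \<open>N k\<close>.\<close>
  define r where "r k = (\<Sum>i\<le>k. N i)" for k
  have r: "N k \<le> r k" "r k \<le> r (Suc k)" for k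
    by (auto simp: r_def intro: member_le_sum)
  have "L2_norm (\<lambda>z. p (r (Suc k)) z - p (r k) z) \<le> (1/2) ^ k" for k
    using r[of k] by (intro less_imp_le[OF N]) auto
  then obtain f where f: "f \<in> L2" "\<And>k. L2_norm (\<lambda>z. f z - p (r k) z) \<le> 2 * (1/2) ^ k"
    using L2_complete_geometric[of "\<lambda>k. p (r k)"] p by metis
  have "(\<lambda>n. L2_norm (\<lambda>z. p n z - f z)) \<longlonglongrightarrow> 0"
  proof (rule LIMSEQ_I)
    fix e :: real assume "e > 0"
    then obtain k :: nat where k: "(1/2) ^ k < e / 3"
      using real_arch_pow_inv[of "e / 3" "1/2"] by auto
    have "norm (L2_norm (\<lambda>z. p n z - f z) - 0) < e" if "n \<ge> r k" for n
    proof -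
      have "L2_norm (\<lambda>z. p n z - f z)
          \<le> L2_norm (\<lambda>z. p n z - p (r k) z) + L2_norm (\<lambda>z. f z - p (r k) z)"
        using L2_norm_triangle_diff[OF p[of n] p[of "r k"] f(1)]
        by (simp add: L2_norm_minus_commute[of f])
      also have "\<dots> < (1/2) ^ k + 2 * (1/2) ^ k"
        using r(1)[of k] that f(2)[of k] by (intro add_less_le_mono N) auto
      finally show ?thesis using k L2_norm_nonneg by simp
    qed
    then show "\<exists>no. \<forall>n\<ge>no. norm (L2_norm (\<lambda>z. p n z - f z) - 0) < e" by blast
  qed
  then show ?thesis using f(1) that by blast
qed

lemma fourier_coeff_tendsto:
  assumes "\<And>k. p k \<in> L2" "f \<in> L2" "(\<lambda>k. L2_norm (\<lambda>z. p k z - f z)) \<longlonglongrightarrow> 0"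
  shows "(\<lambda>k. fourier_coeff (p k) n) \<longlonglongrightarrow> fourier_coeff f n"
proof -
  have "(\<lambda>k. fourier_coeff (p k) n - fourier_coeff f n) \<longlonglongrightarrow> 0"
  proof (rule Lim_null_comparison[OF _ assms(3)])
    show "\<forall>\<^sub>F k in sequentially. norm (fourier_coeff (p k) n - fourier_coeff f n) \<le> L2_norm (\<lambda>z. p k z - f z)"
      using cmod_fourier_coeff_le[OF L2_diff[OF assms(1,2)]] assms by (simp add: fourier_coeff_diff)
  qed
  then show ?thesis by (simp add: LIM_zero_iff)
qed

lemma trig_poly_diff:
  "finite F \<Longrightarrow> G \<subseteq> F \<Longrightarrow> trig_poly a F z - trig_poly a G z = trig_poly a (F - G) z"
  by (simp add: sum_diff)

text \<open>The squared distance of two symmetric partial sums is an increment of the bounded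
  monotone sequence \<open>s\<close>, so they are Cauchy; each Fourier coefficient is continuous in
  the norm and passes to the limit.\<close>

theorem Riesz_Fischer:
  fixes c :: "int \<Rightarrow> complex"
  assumes bound: "\<And>F. finite F \<Longrightarrow> (\<Sum>n\<in>F. (cmod (c n))\<^sup>2) \<le> B"
  shows "\<exists>f\<in>L2. (\<forall>n. fourier_coeff f n = c n) \<and>
    (\<lambda>N. L2_norm (\<lambda>z. trig_poly c {-int N..int N} z - f z)) \<longlonglongrightarrow> 0"
proof -
  define s where "s N = (\<Sum>n\<in>{-int N..int N}. (cmod (c n))\<^sup>2)" for N :: nat
  have mono: "s m \<le> s n" if "m \<le> n" for m n
    unfolding s_def using that by (intro sum_mono2) auto
  have "convergent s"
    using mono bound by (intro Bseq_mono_convergent BseqI'[where K = B])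
      (auto simp: s_def sum_nonneg)
  then have Cs: "Cauchy s" by (simp add: Cauchy_convergent_iff)
  have le: "(L2_norm (\<lambda>z. trig_poly c {-int m..int m} z - trig_poly c {-int n..int n} z))\<^sup>2 = s m - s n"
    if "n \<le> m" for m n
  proof -
    have "(L2_norm (\<lambda>z. trig_poly c {-int m..int m} z - trig_poly c {-int n..int n} z))\<^sup>2
        = (L2_norm (trig_poly c ({-int m..int m} - {-int n..int n})))\<^sup>2"
      using that by (subst trig_poly_diff) auto
    also have "\<dots> = s m - s n"
      unfolding s_def using that by (subst L2_norm_trig_poly) (auto simp: sum_diff)
    finally show ?thesis .
  qed
  have eq: "(L2_norm (\<lambda>z. trig_poly c {-int m..int m} z - trig_poly c {-int n..int n} z))\<^sup>2 = \<bar>s m - s n\<bar>"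
    for m n
  proof (cases "n \<le> m")
    case True
    then show ?thesis using le[OF True] mono[OF True] by simp
  next
    case False
    then have "m \<le> n" by simp
    then show ?thesis
      using le[of m n] mono[of m n] by (subst L2_norm_minus_commute) simp
  qed
  have C: "\<exists>N. \<forall>m\<ge>N. \<forall>n\<ge>N. L2_norm (\<lambda>z. trig_poly c {-int m..int m} z - trig_poly c {-int n..int n} z) < e"
    if "e > 0" for e
  proof -
    have "e\<^sup>2 > 0" using that by simp
    with Cs obtain N where N: "\<forall>m\<ge>N. \<forall>n\<ge>N. \<bar>s m - s n\<bar> < e\<^sup>2"
      unfolding Cauchy_def dist_real_def by blast
    have "L2_norm (\<lambda>z. trig_poly c {-int m..int m} z - trig_poly c {-int n..int n} z) < e"
      if "m \<ge> N" "n \<ge> N" for m n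
    proof (rule power_less_imp_less_base)
      show "(L2_norm (\<lambda>z. trig_poly c {-int m..int m} z - trig_poly c {-int n..int n} z))\<^sup>2 < e\<^sup>2"
        unfolding eq using N that by blast
    qed (use \<open>e > 0\<close> in simp)
    then show ?thesis by blast
  qed
  obtain f where f: "f \<in> L2" "(\<lambda>N. L2_norm (\<lambda>z. trig_poly c {-int N..int N} z - f z)) \<longlonglongrightarrow> 0"
    by (rule L2_complete[OF L2_trig_poly C])
  have "fourier_coeff f n = c n" for n
  proof (rule LIMSEQ_unique)
    show "(\<lambda>N. fourier_coeff (trig_poly c {-int N..int N}) n) \<longlonglongrightarrow> fourier_coeff f n"
      by (rule fourier_coeff_tendsto[OF L2_trig_poly f])
    show "(\<lambda>N. fourier_coeff (trig_poly c {-int N..int N}) n) \<longlonglongrightarrow> c n"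
    proof (rule tendsto_eventually, rule eventually_sequentiallyI)
      fix N assume "N \<ge> nat \<bar>n\<bar>"
      then show "fourier_coeff (trig_poly c {-int N..int N}) n = c n"
        by (auto simp: fourier_coeff_trig_poly)
    qed
  qed
  then show ?thesis using f by blast
qed

text \<open>The partial sums converge to some \<open>g\<close> by Riesz-Fischer, and uniqueness of
  the coefficients identifies \<open>g\<close> with \<open>f\<close>.\<close>

corollary trig_poly_fourier_coeff_tendsto:
  assumes f: "f \<in> L2"
  shows "(\<lambda>N. L2_norm (\<lambda>z. trig_poly (fourier_coeff f) {-int N..int N} z - f z)) \<longlonglongrightarrow> 0"
proof -
  obtain g where g: "g \<in> L2" "\<And>n. fourier_coeff g n = fourier_coeff f n"
    and lim: "(\<lambda>N. L2_norm (\<lambda>z. trig_poly (fourier_coeff f) {-int N..int N} z - g z)) \<longlonglongrightarrow> 0"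
    using Riesz_Fischer[of "fourier_coeff f", OF Bessel[OF f]] by blast
  have "AE z in circle. g z = f z"
    using g f by (intro fourier_coeff_eq_imp_AE_eq)
  then have "L2_norm (\<lambda>z. trig_poly (fourier_coeff f) {-int N..int N} z - g z)
      = L2_norm (\<lambda>z. trig_poly (fourier_coeff f) {-int N..int N} z - f z)" for N
    by (intro L2_norm_AE_cong L2_diff L2_trig_poly f g) auto
  with lim show ?thesis by simp
qed

corollary Parseval:
  assumes f: "f \<in> L2"
  shows "(\<lambda>N. \<Sum>n\<in>{-int N..int N}. (cmod (fourier_coeff f n))\<^sup>2) \<longlonglongrightarrow> (L2_norm f)\<^sup>2"
proof -
  let ?p = "\<lambda>N. trig_poly (fourier_coeff f) {-int N..int N}"
  have "(\<lambda>N. (L2_norm f)\<^sup>2 - (L2_norm (\<lambda>z. ?p N z - f z))\<^sup>2) \<longlonglongrightarrow> (L2_norm f)\<^sup>2 - 0\<^sup>2"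
    by (intro tendsto_intros trig_poly_fourier_coeff_tendsto f)
  moreover have "(L2_norm f)\<^sup>2 - (L2_norm (\<lambda>z. ?p N z - f z))\<^sup>2
      = (\<Sum>n\<in>{-int N..int N}. (cmod (fourier_coeff f n))\<^sup>2)" for N
    by (subst L2_norm_minus_commute, subst L2_norm_diff_trig_poly[OF f]) auto
  ultimately show ?thesis by simp
qed

lemma L2_norm_mono_fourier_coeff:
  assumes "f \<in> L2" "g \<in> L2" "\<And>n. cmod (fourier_coeff f n) \<le> cmod (fourier_coeff g n)"
  shows "L2_norm f \<le> L2_norm g"
proof -
  have "(L2_norm f)\<^sup>2 \<le> (L2_norm g)\<^sup>2"
    using assms(3)
    by (intro LIMSEQ_le[OF Parseval[OF assms(1)] Parseval[OF assms(2)]])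
       (auto intro!: exI[of _ 0] sum_mono power_mono)
  then show ?thesis
    by (rule power2_le_imp_le) (rule L2_norm_nonneg)
qed

section \<open>Twisted Toeplitz matrices with bounded symbol\<close>

lemma H2_imp_L2: "f \<in> H2 \<Longrightarrow> f \<in> L2"
  by (simp add: H2_def)

lemma H2_zero: "(\<lambda>z. 0) \<in> H2"
  by (simp add: H2_def L2_zero fourier_coeff_def L2_inner_def)

lemma H2_lincomb: "f \<in> H2 \<Longrightarrow> g \<in> H2 \<Longrightarrow> (\<lambda>z. c * f z + d * g z) \<in> H2"
  by (simp add: H2_def L2_lincomb fourier_coeff_lincomb)

lemma H2_fourier_basis: "0 \<le> n \<Longrightarrow> fourier_basis n \<in> H2"
  by (simp add: H2_def L2_fourier_basis fourier_coeff_basis)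

lemma H2_trig_poly: "finite F \<Longrightarrow> F \<subseteq> {0..} \<Longrightarrow> trig_poly a F \<in> H2"
  by (auto simp: H2_def L2_trig_poly fourier_coeff_trig_poly)

lemma H2_trig_poly_tendsto:
  assumes "f \<in> H2"
  shows "(\<lambda>N. L2_norm (\<lambda>z. trig_poly (fourier_coeff f) {0..int N} z - f z)) \<longlonglongrightarrow> 0"
proof -
  have "trig_poly (fourier_coeff f) {-int N..int N} z = trig_poly (fourier_coeff f) {0..int N} z" for N z
    using assms by (intro sum.mono_neutral_right) (auto simp: H2_def)
  then show ?thesis
    using trig_poly_fourier_coeff_tendsto[OF H2_imp_L2[OF assms]] by simp
qed

section \<open>Bounded operators on the Hardy space, seen through Fourier coefficients\<close>

lemma bounded_operator_H2_closed: "bounded_operator_H2 A \<Longrightarrow> f \<in> H2 \<Longrightarrow> A f \<in> H2"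
  by (simp add: bounded_operator_H2_def)

lemma bounded_operator_H2_bound:
  assumes "bounded_operator_H2 A"
  obtains C where "0 \<le> C" "\<And>f. f \<in> H2 \<Longrightarrow> L2_norm (A f) \<le> C * L2_norm f"
proof -
  obtain C where C: "\<forall>f\<in>H2. L2_norm (A f) \<le> C * L2_norm f"
    using assms by (auto simp: bounded_operator_H2_def)
  have "L2_norm (A f) \<le> \<bar>C\<bar> * L2_norm f" if "f \<in> H2" for f
    using C[rule_format, OF that] by (rule order_trans) (intro mult_right_mono L2_norm_nonneg abs_ge_self)
  then show ?thesis using that[of "\<bar>C\<bar>"] by simp
qed

text \<open>Operators are linear only up to null sets; Fourier coefficients ignore null sets, so at
  their level linearity is an exact identity.\<close>

lemma fourier_coeff_operator_lincomb:
  assumes "bounded_operator_H2 A" "f \<in> H2" "g \<in> H2"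
  shows "fourier_coeff (A (\<lambda>w. c * f w + d * g w)) n = c * fourier_coeff (A f) n + d * fourier_coeff (A g) n"
proof -
  have L: "A h \<in> L2" if "h \<in> H2" for h
    by (rule H2_imp_L2[OF bounded_operator_H2_closed[OF assms(1) that]])
  have "fourier_coeff (A (\<lambda>w. c * f w + d * g w)) n = fourier_coeff (\<lambda>z. c * A f z + d * A g z) n"
    using assms by (intro fourier_coeff_AE_cong L2_lincomb L H2_lincomb) (auto simp: bounded_operator_H2_def)
  also have "\<dots> = c * fourier_coeff (A f) n + d * fourier_coeff (A g) n"
    using assms by (intro fourier_coeff_lincomb L)
  finally show ?thesis .
qed

lemma fourier_coeff_operator_trig_poly:
  assumes A: "bounded_operator_H2 A" and "finite F" "F \<subseteq> {0..}"
  shows "fourier_coeff (A (trig_poly a F)) n = (\<Sum>j\<in>F. a j * fourier_coeff (A (fourier_basis j)) n)"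
  using assms(2,3)
proof (induction rule: finite_induct)
  case empty
  show ?case
    \<comment> \<open>Linearity with both scalars 0 shows that the image of the zero function has
      zero coefficients.\<close>
    using fourier_coeff_operator_lincomb[OF A H2_zero H2_zero, of 0 0 n] by simp
next
  case (insert k F)
  then show ?case
    using fourier_coeff_operator_lincomb[OF A H2_fourier_basis[of k] H2_trig_poly[of F a], of "a k" 1 n]
    by simp
qed

lemma fourier_coeff_operator_tendsto:
  assumes A: "bounded_operator_H2 A" and p: "\<And>k. p k \<in> H2" and f: "f \<in> H2"
    and lim: "(\<lambda>k. L2_norm (\<lambda>z. p k z - f z)) \<longlonglongrightarrow> 0"
  shows "(\<lambda>k. fourier_coeff (A (p k)) n) \<longlonglongrightarrow> fourier_coeff (A f) n"
proof -
  obtain C where C: "\<And>f. f \<in> H2 \<Longrightarrow> L2_norm (A f) \<le> C * L2_norm f"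
    using bounded_operator_H2_bound[OF A] by blast
  have "(\<lambda>k. fourier_coeff (A (p k)) n - fourier_coeff (A f) n) \<longlonglongrightarrow> 0"
  proof (rule Lim_null_comparison)
    show "\<forall>\<^sub>F k in sequentially. norm (fourier_coeff (A (p k)) n - fourier_coeff (A f) n)
        \<le> C * L2_norm (\<lambda>z. p k z - f z)"
    proof (intro always_eventually allI)
      fix k
      have H: "(\<lambda>z. p k z - f z) \<in> H2"
        using H2_lincomb[OF p[of k] f, of 1 "-1"] by simp
      have "fourier_coeff (A (p k)) n - fourier_coeff (A f) n = fourier_coeff (A (\<lambda>z. p k z - f z)) n"
        using fourier_coeff_operator_lincomb[OF A p[of k] f, of 1 "-1" n] by simp
      also have "norm \<dots> \<le> L2_norm (A (\<lambda>z. p k z - f z))"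
        by (rule cmod_fourier_coeff_le[OF H2_imp_L2[OF bounded_operator_H2_closed[OF A H]]])
      also have "\<dots> \<le> C * L2_norm (\<lambda>z. p k z - f z)"
        by (rule C[OF H])
      finally show "norm (fourier_coeff (A (p k)) n - fourier_coeff (A f) n) \<le> C * L2_norm (\<lambda>z. p k z - f z)" .
    qed
    show "(\<lambda>k. C * L2_norm (\<lambda>z. p k z - f z)) \<longlonglongrightarrow> 0"
      using tendsto_mult_right_zero[OF lim] by simp
  qed
  then show ?thesis by (simp add: LIM_zero_iff)
qed

section \<open>Essentially bounded symbols and the operators they induce\<close>

lemma Linf_bound:
  assumes "\<psi> \<in> Linf"
  obtains M where "0 \<le> M" "Linf_norm \<psi> = ereal M" "AE z in circle. cmod (\<psi> z) \<le> M"
proof -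
  have m: "(\<lambda>z. ereal (cmod (\<psi> z))) \<in> borel_measurable circle"
    using assms by (auto simp: Linf_def)
  \<comment> \<open>The essential supremum is an extended real. Comparison with the zero function,
    whose essential supremum is 0 on a probability space, rules out negative values.\<close>
  have "esssup circle (\<lambda>z. 0 :: ereal) \<le> Linf_norm \<psi>"
    unfolding Linf_norm_def by (rule esssup_mono) auto
  then have "0 \<le> Linf_norm \<psi>"
    using circle.emeasure_space_1 by (simp add: esssup_const)
  moreover have "Linf_norm \<psi> < \<infinity>" using assms by (simp add: Linf_def)
  ultimately obtain M where "Linf_norm \<psi> = ereal M" "0 \<le> M"
    by (cases "Linf_norm \<psi>") auto
  then show ?thesis
    using esssup_AE[of "\<lambda>z. ereal (cmod (\<psi> z))" circle] that by (simp add: Linf_norm_def)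
qed

text \<open>For unimodular \<open>\<mu>\<close> this is the matrix of \<open>T\<^sub>\<psi>\<close> followed by the diagonal unitary with
  entries \<open>\<mu>\<^sup>i\<close>. Both matrices of the theorem have this form.\<close>

definition twisted_toeplitz :: "complex \<Rightarrow> (complex \<Rightarrow> complex) \<Rightarrow> nat \<Rightarrow> nat \<Rightarrow> complex" where
  "twisted_toeplitz \<mu> \<psi> i j = \<mu> ^ i * fourier_coeff \<psi> (int i - int j)"

lemma has_matrix_twisted_toeplitz:
  assumes "has_matrix A (twisted_toeplitz \<mu> \<psi>)" "0 \<le> i" "0 \<le> j"
  shows "fourier_coeff (A (fourier_basis j)) i = \<mu> powi i * fourier_coeff \<psi> (i - j)"
  using assms(1)[unfolded has_matrix_def, rule_format, of "nat j" "nat i"] assms(2,3)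
  by (simp add: twisted_toeplitz_def fourier_coeff_def power_int_def)

lemma L2_mult_basis: "f \<in> L2 \<Longrightarrow> (\<lambda>z. f z * fourier_basis n z) \<in> L2"
  by (intro L2_mult_continuous continuous_on_fourier_basis)

lemma fourier_coeff_mult_trig_poly:
  assumes "\<psi> \<in> L2"
  shows "fourier_coeff (\<lambda>z. \<psi> z * trig_poly a F z) i = (\<Sum>j\<in>F. a j * fourier_coeff \<psi> (i - j))"
proof -
  have "(\<lambda>z. \<psi> z * trig_poly a F z) = (\<lambda>z. \<Sum>j\<in>F. a j * (\<psi> z * fourier_basis j z))"
    by (simp add: sum_distrib_left algebra_simps)
  then have "fourier_coeff (\<lambda>z. \<psi> z * trig_poly a F z) i
      = (\<Sum>j\<in>F. a j * fourier_coeff (\<lambda>z. \<psi> z * fourier_basis j z) i)"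
    using assms unfolding fourier_coeff_def by (simp add: L2_inner_sum_left L2_mult_basis L2_fourier_basis)
  then show ?thesis by (simp add: fourier_coeff_mult_basis)
qed

text \<open>The matrix determines the operator: the formula holds on the polynomials
  \<open>p N\<close> by linearity and passes to the limit on both sides. Hence every
  \<open>A\<close> with this matrix multiplies by \<open>\<psi>\<close>, projects to the Hardy space
  and twists by powers of \<open>\<mu>\<close>.\<close>

lemma fourier_coeff_twisted_toeplitz_operator:
  assumes A: "bounded_operator_H2 A" "has_matrix A (twisted_toeplitz \<mu> \<psi>)"
    and psi: "\<psi> \<in> Linf" and f: "f \<in> H2" and i: "0 \<le> i"
  shows "fourier_coeff (A f) i = \<mu> powi i * fourier_coeff (\<lambda>z. \<psi> z * f z) i"
proof -
  obtain M where M: "0 \<le> M" "AE z in circle. cmod (\<psi> z) \<le> M"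
    using Linf_bound[OF psi] by metis
  have meas: "\<psi> \<in> borel_measurable circle" using psi by (simp add: Linf_def)
  have psi_L2: "\<psi> \<in> L2" using bounded_imp_L2[OF meas M(2)] .
  note mult_L2 = L2_mult_bounded[OF meas M(2)]
  define p where "p N = trig_poly (fourier_coeff f) {0..int N}" for N
  have p: "p N \<in> H2" for N
    unfolding p_def by (rule H2_trig_poly) auto
  have lim: "(\<lambda>N. L2_norm (\<lambda>z. p N z - f z)) \<longlonglongrightarrow> 0"
    unfolding p_def using H2_trig_poly_tendsto[OF f] .
  have eq: "fourier_coeff (A (p N)) i = \<mu> powi i * fourier_coeff (\<lambda>z. \<psi> z * p N z) i" for N
  proof -
    have "fourier_coeff (A (p N)) i
        = (\<Sum>j\<in>{0..int N}. fourier_coeff f j * fourier_coeff (A (fourier_basis j)) i)"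
      unfolding p_def by (rule fourier_coeff_operator_trig_poly[OF A(1)]) auto
    also have "\<dots> = (\<Sum>j\<in>{0..int N}. fourier_coeff f j * (\<mu> powi i * fourier_coeff \<psi> (i - j)))"
      by (intro sum.cong) (auto simp: has_matrix_twisted_toeplitz[OF A(2) i])
    also have "\<dots> = \<mu> powi i * fourier_coeff (\<lambda>z. \<psi> z * p N z) i"
      unfolding p_def fourier_coeff_mult_trig_poly[OF psi_L2]
      by (simp add: sum_distrib_left mult.left_commute)
    finally show ?thesis .
  qed
  \<comment> \<open>The essential bound \<open>M\<close> makes multiplication by
    \<open>\<psi>\<close> continuous in the norm.\<close>
  have "(\<lambda>N. L2_norm (\<lambda>z. \<psi> z * p N z - \<psi> z * f z)) \<longlonglongrightarrow> 0"
  proof (rule Lim_null_comparison)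
    show "\<forall>\<^sub>F N in sequentially. norm (L2_norm (\<lambda>z. \<psi> z * p N z - \<psi> z * f z)) \<le> M * L2_norm (\<lambda>z. p N z - f z)"
      using L2_norm_mult_bounded[OF meas M(2,1) L2_diff[OF H2_imp_L2[OF p] H2_imp_L2[OF f]]]
      by (simp add: L2_norm_nonneg right_diff_distrib)
    show "(\<lambda>N. M * L2_norm (\<lambda>z. p N z - f z)) \<longlonglongrightarrow> 0"
      using tendsto_mult_right_zero[OF lim] by simp
  qed
  then have "(\<lambda>N. fourier_coeff (\<lambda>z. \<psi> z * p N z) i) \<longlonglongrightarrow> fourier_coeff (\<lambda>z. \<psi> z * f z) i"
    by (intro fourier_coeff_tendsto mult_L2 H2_imp_L2 p f)
  then have "(\<lambda>N. fourier_coeff (A (p N)) i) \<longlonglongrightarrow> \<mu> powi i * fourier_coeff (\<lambda>z. \<psi> z * f z) i"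
    unfolding eq by (intro tendsto_intros)
  moreover have "(\<lambda>N. fourier_coeff (A (p N)) i) \<longlonglongrightarrow> fourier_coeff (A f) i"
    by (rule fourier_coeff_operator_tendsto[OF A(1) p f lim])
  ultimately show ?thesis by (rule LIMSEQ_unique[symmetric])
qed

text \<open>Replaces the contractivity of the projection onto the Hardy space and the unitarity of
  the diagonal twist: moduli of coefficients are kept at indices from 0 on and become 0
  below.\<close>

lemma L2_norm_le_of_hardy_coeff:
  assumes "cmod \<mu> = 1" "g \<in> H2" "h \<in> L2"
    and "\<And>i. 0 \<le> i \<Longrightarrow> fourier_coeff g i = \<mu> powi i * fourier_coeff h i"
  shows "L2_norm g \<le> L2_norm h"
proof (rule L2_norm_mono_fourier_coeff[OF H2_imp_L2[OF assms(2)] assms(3)])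
  fix n :: int
  show "cmod (fourier_coeff g n) \<le> cmod (fourier_coeff h n)"
    using assms by (cases "0 \<le> n") (auto simp: H2_def norm_mult norm_power_int)
qed

lemma twisted_toeplitz_operator_norm_le:
  assumes "cmod \<mu> = 1" "bounded_operator_H2 A" "has_matrix A (twisted_toeplitz \<mu> \<psi>)" "\<psi> \<in> Linf"
    and M: "AE z in circle. cmod (\<psi> z) \<le> M" "0 \<le> M" and f: "f \<in> H2"
  shows "L2_norm (A f) \<le> M * L2_norm f"
proof -
  have meas: "\<psi> \<in> borel_measurable circle" using assms(4) by (simp add: Linf_def)
  have "L2_norm (A f) \<le> L2_norm (\<lambda>z. \<psi> z * f z)"
    by (rule L2_norm_le_of_hardy_coeff[OF assms(1) bounded_operator_H2_closed[OF assms(2) f]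
          L2_mult_bounded[OF meas M(1) H2_imp_L2[OF f]]
          fourier_coeff_twisted_toeplitz_operator[OF assms(2-4) f]])
  also have "\<dots> \<le> M * L2_norm f"
    by (rule L2_norm_mult_bounded[OF meas M H2_imp_L2[OF f]])
  finally show ?thesis .
qed

text \<open>Builds the projected and twisted function directly from its coefficients: Bessel for
  \<open>h\<close> supplies the square-sum bound that Riesz-Fischer asks for.\<close>

lemma hardy_function_exists:
  assumes "cmod \<mu> = 1" "h \<in> L2"
  shows "\<exists>g\<in>H2. \<forall>i\<ge>0. fourier_coeff g i = \<mu> powi i * fourier_coeff h i"
proof -
  define c where "c n = (if 0 \<le> n then \<mu> powi n * fourier_coeff h n else 0)" for n :: int
  have "(\<Sum>n\<in>F. (cmod (c n))\<^sup>2) \<le> (L2_norm h)\<^sup>2" if "finite F" for F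
  proof -
    have "(\<Sum>n\<in>F. (cmod (c n))\<^sup>2) \<le> (\<Sum>n\<in>F. (cmod (fourier_coeff h n))\<^sup>2)"
      using assms(1) by (intro sum_mono) (auto simp: c_def norm_mult norm_power_int)
    also have "\<dots> \<le> (L2_norm h)\<^sup>2" by (rule Bessel[OF assms(2) that])
    finally show ?thesis .
  qed
  then obtain g where "g \<in> L2" "\<And>n. fourier_coeff g n = c n"
    using Riesz_Fischer[of c] by blast
  then show ?thesis by (intro bexI[of _ g]) (auto simp: c_def H2_def)
qed

lemma matrix_bounded_twisted_toeplitz:
  assumes mu: "cmod \<mu> = 1" and psi: "\<psi> \<in> Linf"
  shows "matrix_bounded (twisted_toeplitz \<mu> \<psi>)"
proof -
  obtain M where M: "0 \<le> M" "AE z in circle. cmod (\<psi> z) \<le> M"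
    using Linf_bound[OF psi] by metis
  have meas: "\<psi> \<in> borel_measurable circle" using psi by (simp add: Linf_def)
  note mult_L2 = L2_mult_bounded[OF meas M(2) H2_imp_L2]
  \<comment> \<open>A representative is chosen separately for each \<open>f\<close>, so linearity
    can hold only almost everywhere and is derived below from equality of coefficients.\<close>
  obtain A where A: "\<And>f. f \<in> H2 \<Longrightarrow> A f \<in> H2"
    "\<And>f i. f \<in> H2 \<Longrightarrow> 0 \<le> i \<Longrightarrow> fourier_coeff (A f) i = \<mu> powi i * fourier_coeff (\<lambda>z. \<psi> z * f z) i"
    using hardy_function_exists[OF mu mult_L2] by metis
  have "bounded_operator_H2 A"
    unfolding bounded_operator_H2_def
  proof (intro conjI ballI allI exI[of _ M])
    fix f g c d assume f: "f \<in> H2" and g: "g \<in> H2"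
    let ?h = "\<lambda>w. c * f w + d * g w"
    have h: "?h \<in> H2" using f g by (rule H2_lincomb)
    show "AE z in circle. A ?h z = c * A f z + d * A g z"
    proof (intro fourier_coeff_eq_imp_AE_eq L2_lincomb H2_imp_L2 A(1) f g h)
      fix n
      have 1: "fourier_coeff (\<lambda>z. c * A f z + d * A g z) n = c * fourier_coeff (A f) n + d * fourier_coeff (A g) n"
        by (intro fourier_coeff_lincomb H2_imp_L2 A(1) f g)
      show "fourier_coeff (A ?h) n = fourier_coeff (\<lambda>z. c * A f z + d * A g z) n"
      proof (cases "0 \<le> n")
        case True
        have "fourier_coeff (\<lambda>z. \<psi> z * ?h z) n
            = fourier_coeff (\<lambda>z. c * (\<psi> z * f z) + d * (\<psi> z * g z)) n"
          by (simp add: algebra_simps)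
        also have "\<dots> = c * fourier_coeff (\<lambda>z. \<psi> z * f z) n + d * fourier_coeff (\<lambda>z. \<psi> z * g z) n"
          by (intro fourier_coeff_lincomb mult_L2 f g)
        finally show ?thesis
          unfolding 1 using True by (simp add: A(2) f g h algebra_simps)
      next
        case False
        then show ?thesis unfolding 1 using A(1)[OF f] A(1)[OF g] A(1)[OF h] by (simp add: H2_def)
      qed
    qed
  next
    fix f assume f: "f \<in> H2"
    then show "A f \<in> H2" by (rule A(1))
    have "L2_norm (A f) \<le> L2_norm (\<lambda>z. \<psi> z * f z)"
      by (rule L2_norm_le_of_hardy_coeff[OF mu A(1)[OF f] mult_L2[OF f] A(2)[OF f]])
    also have "\<dots> \<le> M * L2_norm f"
      by (rule L2_norm_mult_bounded[OF meas M(2,1) H2_imp_L2[OF f]])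
    finally show "L2_norm (A f) \<le> M * L2_norm f" .
  qed
  moreover have "has_matrix A (twisted_toeplitz \<mu> \<psi>)"
    unfolding has_matrix_def fourier_coeff_def[symmetric] twisted_toeplitz_def
    by (simp add: A(2) H2_fourier_basis fourier_coeff_mult_basis)
  ultimately show ?thesis by (auto simp: matrix_bounded_def)
qed

section \<open>Fejer means and the symbol bound\<close>

text \<open>The usual mean has weights \<open>1 - |n| / N\<close> for \<open>|n| < N\<close>. They
  arise here because \<open>n\<close> occurs \<open>N - |n|\<close> times as a difference
  \<open>i - j\<close>; the double sum has the shape of a matrix coefficient.\<close>

definition fejer_mean :: "(complex \<Rightarrow> complex) \<Rightarrow> nat \<Rightarrow> complex \<Rightarrow> complex" where
  "fejer_mean \<psi> N z
    = (\<Sum>i\<in>{0..<int N}. \<Sum>j\<in>{0..<int N}. fourier_coeff \<psi> (i - j) * fourier_basis (i - j) z) / N"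

lemma fejer_mean_eq:
  "fejer_mean \<psi> N = (\<lambda>z. \<Sum>i\<in>{0..<int N}. (1 / of_nat N)
      * (\<Sum>j\<in>{0..<int N}. fourier_coeff \<psi> (i - j) * fourier_basis (i - j) z))"
  by (simp add: fejer_mean_def fun_eq_iff sum_divide_distrib)

lemma fejer_mean_L2: "fejer_mean \<psi> N \<in> L2"
  unfolding fejer_mean_eq by (intro L2_sum L2_fourier_basis)

lemma fourier_coeff_fejer_mean:
  "fourier_coeff (fejer_mean \<psi> N) n = real (card {i \<in> {0..<int N}. i - n \<in> {0..<int N}}) / N * fourier_coeff \<psi> n"
proof -
  have outer: "L2_inner (fejer_mean \<psi> N) (fourier_basis n) = (\<Sum>i\<in>{0..<int N}. (1 / of_nat N)
      * L2_inner (\<lambda>z. \<Sum>j\<in>{0..<int N}. fourier_coeff \<psi> (i - j) * fourier_basis (i - j) z) (fourier_basis n))"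
    unfolding fejer_mean_eq by (rule L2_inner_sum_left[OF L2_sum[OF L2_fourier_basis] L2_fourier_basis])
  have inner: "L2_inner (\<lambda>z. \<Sum>j\<in>{0..<int N}. fourier_coeff \<psi> (i - j) * fourier_basis (i - j) z) (fourier_basis n)
      = (\<Sum>j\<in>{0..<int N}. fourier_coeff \<psi> (i - j) * L2_inner (fourier_basis (i - j)) (fourier_basis n))" for i
    by (rule L2_inner_sum_left[OF L2_fourier_basis L2_fourier_basis])
  have "fourier_coeff (fejer_mean \<psi> N) n = (\<Sum>i\<in>{0..<int N}. (1 / of_nat N)
      * (\<Sum>j\<in>{0..<int N}. fourier_coeff \<psi> (i - j) * fourier_coeff (fourier_basis (i - j)) n))"
    unfolding fourier_coeff_def[of _ n] outer inner ..
  also have "\<dots> = (\<Sum>i\<in>{0..<int N}. (1 / of_nat N) * (\<Sum>j\<in>{0..<int N}. if j = i - n then fourier_coeff \<psi> n else 0))"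
    by (intro sum.cong arg_cong2[where f = "(*)"]) (auto simp: fourier_coeff_basis)
  also have "\<dots> = (\<Sum>i\<in>{0..<int N}. if i - n \<in> {0..<int N} then fourier_coeff \<psi> n / N else 0)"
    by (intro sum.cong) auto
  also have "\<dots> = (\<Sum>i\<in>{i \<in> {0..<int N}. i - n \<in> {0..<int N}}. fourier_coeff \<psi> n / N)"
    by (rule sum.inter_filter[symmetric]) simp
  finally show ?thesis by simp
qed

lemma fourier_coeff_fejer_mean_tendsto:
  "(\<lambda>N. fourier_coeff (fejer_mean \<psi> N) n) \<longlonglongrightarrow> fourier_coeff \<psi> n"
proof -
  have "(\<lambda>N. 1 - real_of_int \<bar>n\<bar> / real N) \<longlonglongrightarrow> 1 - 0"
    by (intro tendsto_intros lim_const_over_n)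
  then have "(\<lambda>N. complex_of_real (1 - real_of_int \<bar>n\<bar> / real N) * fourier_coeff \<psi> n)
      \<longlonglongrightarrow> complex_of_real (1 - 0) * fourier_coeff \<psi> n"
    by (intro tendsto_intros)
  moreover have "\<forall>\<^sub>F N in sequentially. complex_of_real (1 - real_of_int \<bar>n\<bar> / real N) * fourier_coeff \<psi> n
      = fourier_coeff (fejer_mean \<psi> N) n"
  proof (rule eventually_sequentiallyI)
    fix N assume N: "Suc (nat \<bar>n\<bar>) \<le> N"
    have "{i \<in> {0..<int N}. i - n \<in> {0..<int N}} = {max 0 n..<min (int N) (int N + n)}"
      by auto
    then have "card {i \<in> {0..<int N}. i - n \<in> {0..<int N}} = nat (int N - \<bar>n\<bar>)"
      by (simp add: min_def max_def)
    \<comment> \<open>Here \<open>N\<close> exceeds the modulus of \<open>n\<close>, so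
      \<open>nat\<close> does not truncate.\<close>
    then have "real (card {i \<in> {0..<int N}. i - n \<in> {0..<int N}}) = real N - real_of_int \<bar>n\<bar>"
      using N by simp
    then have "real (card {i \<in> {0..<int N}. i - n \<in> {0..<int N}}) / N = 1 - real_of_int \<bar>n\<bar> / real N"
      using N by (simp add: diff_divide_distrib)
    then show "complex_of_real (1 - real_of_int \<bar>n\<bar> / real N) * fourier_coeff \<psi> n
      = fourier_coeff (fejer_mean \<psi> N) n"
      by (simp only: fourier_coeff_fejer_mean)
  qed
  ultimately show ?thesis by (simp add: tendsto_cong)
qed

text \<open>The Fejer mean at \<open>w\<close> is a matrix coefficient of the operator between unit vectors,
  normalised truncations of geometric sequences such as the one with ratio \<open>cnj w\<close>.\<close>

lemma cmod_fejer_mean_le: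
  assumes mu: "cmod \<mu> = 1" and A: "bounded_operator_H2 A" "has_matrix A (twisted_toeplitz \<mu> \<psi>)"
    and C: "\<And>f. f \<in> H2 \<Longrightarrow> L2_norm f \<le> 1 \<Longrightarrow> L2_norm (A f) \<le> C"
    and w: "cmod w = 1" and N: "N > 0"
  shows "cmod (fejer_mean \<psi> N w) \<le> C"
proof -
  let ?F = "{0..<int N}"
  \<comment> \<open>There are \<open>N\<close> entries of modulus \<open>1 / sqrt N\<close>, so both
    vectors have norm 1. The phases are chosen so that \<open>x j\<close> and
    \<open>cnj (y i)\<close> combine to \<open>w powi (i - j)\<close>; the extra
    \<open>\<mu>\<close> in \<open>y\<close> cancels the twist of row \<open>i\<close>.\<close>
  define x where "x j = cnj w powi j / sqrt N" for j :: int
  define y where "y i = (\<mu> * cnj w) powi i / sqrt N" for i :: int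
  have w0: "w \<noteq> 0" "\<mu> \<noteq> 0" using w mu by auto
  have norm1: "L2_norm (trig_poly a ?F) = 1" if "\<And>i. cmod (a i) = 1 / sqrt N" for a
  proof -
    have "(L2_norm (trig_poly a ?F))\<^sup>2 = 1"
      using that N by (subst L2_norm_trig_poly) (auto simp: power_divide)
    then show ?thesis using L2_norm_nonneg[of "trig_poly a ?F"] by (simp add: power2_eq_1_iff)
  qed
  have nx: "L2_norm (trig_poly x ?F) = 1" and ny: "L2_norm (trig_poly y ?F) = 1"
    by (rule norm1, simp add: x_def y_def norm_divide norm_power_int norm_mult w mu)+
  have xH: "trig_poly x ?F \<in> H2" by (rule H2_trig_poly) auto
  have AL: "A (trig_poly x ?F) \<in> L2"
    by (rule H2_imp_L2[OF bounded_operator_H2_closed[OF A(1) xH]])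
  have entry: "cnj (y i) * (x j * (\<mu> powi i * fourier_coeff \<psi> (i - j)))
      = fourier_coeff \<psi> (i - j) * fourier_basis (i - j) w / N" for i j
  proof -
    have "cnj (y i) * \<mu> powi i = w powi i / sqrt N"
      using w0 by (simp add: y_def power_int_mult_distrib power_int_inverse cmod_1_cnj[OF mu])
    moreover have "x j = w powi (- j) / sqrt N"
      by (simp add: x_def cmod_1_cnj[OF w] power_int_inverse power_int_minus)
    ultimately have "cnj (y i) * \<mu> powi i * x j = w powi i * w powi (- j) / (complex_of_real (sqrt N) * complex_of_real (sqrt N))"
      by simp
    also have "\<dots> = fourier_basis (i - j) w / N"
      using w0 by (simp add: fourier_basis_def power_int_diff power_int_minus field_simps flip: of_real_mult)
    finally have "cnj (y i) * \<mu> powi i * x j = fourier_basis (i - j) w / N" .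
    moreover have "cnj (y i) * (x j * (\<mu> powi i * fourier_coeff \<psi> (i - j)))
        = fourier_coeff \<psi> (i - j) * (cnj (y i) * \<mu> powi i * x j)"
      by (simp only: ac_simps)
    ultimately show ?thesis by simp
  qed
  have "L2_inner (A (trig_poly x ?F)) (trig_poly y ?F)
      = (\<Sum>i\<in>?F. cnj (y i) * (\<Sum>j\<in>?F. x j * fourier_coeff (A (fourier_basis j)) i))"
    unfolding L2_inner_trig_poly_right[OF AL]
    by (intro sum.cong arg_cong2[where f = "(*)"] fourier_coeff_operator_trig_poly A(1)) auto
  also have "\<dots> = (\<Sum>i\<in>?F. \<Sum>j\<in>?F. cnj (y i) * (x j * (\<mu> powi i * fourier_coeff \<psi> (i - j))))"
    unfolding sum_distrib_left
    by (intro sum.cong) (auto simp: has_matrix_twisted_toeplitz[OF A(2)])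
  also have "\<dots> = fejer_mean \<psi> N w"
    unfolding entry fejer_mean_def by (simp add: sum_divide_distrib)
  finally have "fejer_mean \<psi> N w = L2_inner (A (trig_poly x ?F)) (trig_poly y ?F)" ..
  also have "cmod \<dots> \<le> L2_norm (A (trig_poly x ?F)) * L2_norm (trig_poly y ?F)"
    by (rule L2_Cauchy_Schwarz[OF AL L2_trig_poly])
  also have "\<dots> \<le> C"
    using C[OF xH] by (simp add: nx ny)
  finally show ?thesis .
qed

text \<open>A bound by the 1-norm, tested on indicator functions, confines all averages of
  \<open>\<psi>\<close> to a disc; it is obtained first for trigonometric polynomials and then by
  approximation.\<close>

lemma AE_bound_of_fejer_mean_bound:
  assumes psi: "\<psi> \<in> L2" and C: "\<And>N w. cmod w = 1 \<Longrightarrow> N > 0 \<Longrightarrow> cmod (fejer_mean \<psi> N w) \<le> C"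
  shows "AE z in circle. cmod (\<psi> z) \<le> C"
proof -
  have "0 \<le> C" using order_trans[OF norm_ge_zero C[of 1 1]] by simp
  \<comment> \<open>Such a pairing involves finitely many coefficients, so coefficientwise
    convergence of the Fejer means suffices.\<close>
  have poly: "cmod (L2_inner \<psi> (trig_poly a F)) \<le> C * (\<integral>z. cmod (trig_poly a F z) \<partial>circle)"
    for a F
  proof (rule tendsto_upperbound)
    show "(\<lambda>N. cmod (L2_inner (fejer_mean \<psi> N) (trig_poly a F))) \<longlonglongrightarrow> cmod (L2_inner \<psi> (trig_poly a F))"
      unfolding L2_inner_trig_poly_right[OF fejer_mean_L2] L2_inner_trig_poly_right[OF psi]
      by (intro tendsto_intros fourier_coeff_fejer_mean_tendsto)
    show "\<forall>\<^sub>F N in sequentially. cmod (L2_inner (fejer_mean \<psi> N) (trig_poly a F))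
        \<le> C * (\<integral>z. cmod (trig_poly a F z) \<partial>circle)"
    proof (rule eventually_sequentiallyI)
      fix N assume "Suc 0 \<le> N"
      have "cmod (L2_inner (fejer_mean \<psi> N) (trig_poly a F))
          \<le> (\<integral>z. cmod (fejer_mean \<psi> N z * cnj (trig_poly a F z)) \<partial>circle)"
        unfolding L2_inner_def by (rule integral_norm_bound)
      also have "\<dots> \<le> (\<integral>z. C * cmod (trig_poly a F z) \<partial>circle)"
      proof (rule integral_mono)
        fix z assume "z \<in> space circle"
        then have "cmod (fejer_mean \<psi> N z) \<le> C"
          using \<open>Suc 0 \<le> N\<close> by (intro C) (auto simp: space_circle)
        then show "cmod (fejer_mean \<psi> N z * cnj (trig_poly a F z)) \<le> C * cmod (trig_poly a F z)"
          unfolding norm_mult complex_mod_cnj by (rule mult_right_mono) simp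
      qed (intro integrable_norm integrable_mult_right L2_integrable_inner L2_integrable L2_trig_poly fejer_mean_L2)+
      finally show "cmod (L2_inner (fejer_mean \<psi> N) (trig_poly a F)) \<le> C * (\<integral>z. cmod (trig_poly a F z) \<partial>circle)"
        by simp
    qed
  qed simp
  have L2: "cmod (L2_inner \<psi> g) \<le> C * (\<integral>z. cmod (g z) \<partial>circle)" if g: "g \<in> L2" for g
  proof -
    define p where "p N = trig_poly (fourier_coeff g) {-int N..int N}" for N
    have p: "p N \<in> L2" for N unfolding p_def by (rule L2_trig_poly)
    let ?e = "\<lambda>N. L2_norm (\<lambda>z. p N z - g z)"
    have e: "?e \<longlonglongrightarrow> 0"
      unfolding p_def by (rule trig_poly_fourier_coeff_tendsto[OF g])
    \<comment> \<open>The remainder of \<open>g\<close> is paired by Cauchy-Schwarz, the partial sum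
      \<open>p N\<close> by \<open>poly\<close>; the 1-norm of \<open>p N\<close> exceeds that of
      \<open>g\<close> by at most \<open>?e N\<close>.\<close>
    have "cmod (L2_inner \<psi> g) \<le> L2_norm \<psi> * ?e N + C * ((\<integral>z. cmod (g z) \<partial>circle) + ?e N)" for N
    proof -
      have "cmod (L2_inner \<psi> g) \<le> cmod (L2_inner \<psi> (\<lambda>z. g z - p N z)) + cmod (L2_inner \<psi> (p N))"
        using norm_triangle_ineq[of "L2_inner \<psi> (\<lambda>z. g z - p N z)" "L2_inner \<psi> (p N)"]
        by (simp add: L2_inner_diff_right[OF g p psi])
      moreover have "cmod (L2_inner \<psi> (\<lambda>z. g z - p N z)) \<le> L2_norm \<psi> * ?e N"
        using L2_Cauchy_Schwarz[OF psi L2_diff[OF g p]] by (subst L2_norm_minus_commute)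
      moreover have "cmod (L2_inner \<psi> (p N)) \<le> C * ((\<integral>z. cmod (g z) \<partial>circle) + ?e N)"
      proof -
        note int = integrable_norm[OF L2_integrable[OF p[of N]]] integrable_norm[OF L2_integrable[OF g]]
          integrable_norm[OF L2_integrable[OF L2_diff[OF p[of N] g]]]
        have "(\<integral>z. cmod (p N z) \<partial>circle) \<le> (\<integral>z. cmod (g z) + cmod (p N z - g z) \<partial>circle)"
        proof (rule integral_mono[OF int(1) Bochner_Integration.integrable_add[OF int(2,3)]])
          show "cmod (p N z) \<le> cmod (g z) + cmod (p N z - g z)" for z
            using norm_triangle_ineq[of "g z" "p N z - g z"] by simp
        qed
        also have "\<dots> = (\<integral>z. cmod (g z) \<partial>circle) + (\<integral>z. cmod (p N z - g z) \<partial>circle)"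
          by (rule Bochner_Integration.integral_add[OF int(2,3)])
        also have "\<dots> \<le> (\<integral>z. cmod (g z) \<partial>circle) + ?e N"
          using L1_le_L2_norm[OF L2_diff[OF p[of N] g]] by simp
        finally have "C * (\<integral>z. cmod (p N z) \<partial>circle) \<le> C * ((\<integral>z. cmod (g z) \<partial>circle) + ?e N)"
          using \<open>0 \<le> C\<close> by (rule mult_left_mono)
        then show ?thesis using poly[of "fourier_coeff g" "{-int N..int N}"] by (simp add: p_def)
      qed
      ultimately show ?thesis by linarith
    qed
    moreover have "(\<lambda>N. L2_norm \<psi> * ?e N + C * ((\<integral>z. cmod (g z) \<partial>circle) + ?e N))
        \<longlonglongrightarrow> L2_norm \<psi> * 0 + C * ((\<integral>z. cmod (g z) \<partial>circle) + 0)"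
      by (intro tendsto_intros e)
    ultimately show ?thesis
      by (intro tendsto_lowerbound) (auto intro: always_eventually)
  qed
  \<comment> \<open>A function whose averages over all sets of positive measure lie in a closed set
    takes almost all its values there.\<close>
  have "AE z in circle. \<psi> z \<in> cball 0 C"
  proof (rule circle.averaging_theorem[OF L2_integrable[OF psi] closed_cball])
    fix B assume B: "B \<in> sets circle" "0 < measure circle B"
    have ind: "(indicator B :: complex \<Rightarrow> complex) \<in> L2"
      using B by (intro bounded_imp_L2[where M = 1]) (auto simp: indicator_def intro!: AE_I2)
    have "set_lebesgue_integral circle B \<psi> = L2_inner \<psi> (indicator B)"
      unfolding set_lebesgue_integral_def L2_inner_def
      by (rule Bochner_Integration.integral_cong) (auto simp: indicator_def)
    moreover have "(\<integral>z. cmod (indicator B z) \<partial>circle) = measure circle B"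
    proof -
      have "(\<integral>z. cmod (indicator B z) \<partial>circle) = (\<integral>z. indicator B z \<partial>circle)"
        by (rule Bochner_Integration.integral_cong) (auto simp: indicator_def)
      then show ?thesis using B by simp
    qed
    ultimately have "cmod (set_lebesgue_integral circle B \<psi>) \<le> C * measure circle B"
      using L2[OF ind] by simp
    then show "(1 / measure circle B) *\<^sub>R set_lebesgue_integral circle B \<psi> \<in> cball 0 C"
      using B by (simp add: field_simps)
  qed
  then show ?thesis by simp
qed

text \<open>Stated for any bound \<open>C\<close> on the unit ball, to serve twice: with some
  boundedness constant for membership in \<open>Linf\<close>, and with the operator norm for the
  sharp estimate.\<close>

lemma twisted_toeplitz_AE_bound:
  assumes "cmod \<mu> = 1" "bounded_operator_H2 A" "has_matrix A (twisted_toeplitz \<mu> \<psi>)" "\<psi> \<in> L2"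
    and "\<And>f. f \<in> H2 \<Longrightarrow> L2_norm f \<le> 1 \<Longrightarrow> L2_norm (A f) \<le> C"
  shows "Linf_norm \<psi> \<le> ereal C"
  unfolding Linf_norm_def
proof (rule esssup_I)
  show "AE z in circle. ereal (cmod (\<psi> z)) \<le> ereal C"
    using AE_bound_of_fejer_mean_bound[OF assms(4) cmod_fejer_mean_le[OF assms(1-3,5)]] by simp
qed (use assms(4) in \<open>auto simp: L2_def\<close>)

lemma matrix_bounded_twisted_toeplitz_iff:
  assumes mu: "cmod \<mu> = 1" and psi: "\<psi> \<in> L2"
  shows "matrix_bounded (twisted_toeplitz \<mu> \<psi>) \<longleftrightarrow> \<psi> \<in> Linf"
proof
  assume "matrix_bounded (twisted_toeplitz \<mu> \<psi>)"
  then obtain A where A: "bounded_operator_H2 A" "has_matrix A (twisted_toeplitz \<mu> \<psi>)"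
    by (auto simp: matrix_bounded_def)
  obtain C where C: "0 \<le> C" "\<And>f. f \<in> H2 \<Longrightarrow> L2_norm (A f) \<le> C * L2_norm f"
    using bounded_operator_H2_bound[OF A(1)] by blast
  have "L2_norm (A f) \<le> C" if "f \<in> H2" "L2_norm f \<le> 1" for f
    using C(2)[OF that(1)] mult_left_mono[OF that(2) C(1)] by simp
  then have "Linf_norm \<psi> \<le> ereal C"
    by (rule twisted_toeplitz_AE_bound[OF mu A psi])
  then show "\<psi> \<in> Linf"
    using psi by (auto simp: Linf_def L2_def)
qed (rule matrix_bounded_twisted_toeplitz[OF mu])

lemma op_norm_twisted_toeplitz:
  assumes mu: "cmod \<mu> = 1" and psi: "\<psi> \<in> L2"
    and A: "bounded_operator_H2 A" "has_matrix A (twisted_toeplitz \<mu> \<psi>)"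
  shows "ereal (op_norm_H2 A) = Linf_norm \<psi>"
proof -
  have Linf: "\<psi> \<in> Linf"
    using A matrix_bounded_twisted_toeplitz_iff[OF mu psi] by (auto simp: matrix_bounded_def)
  obtain M where M: "0 \<le> M" "Linf_norm \<psi> = ereal M" "AE z in circle. cmod (\<psi> z) \<le> M"
    using Linf_bound[OF Linf] .
  have le: "L2_norm (A f) \<le> M" if "f \<in> H2" "L2_norm f \<le> 1" for f
    using twisted_toeplitz_operator_norm_le[OF mu A Linf M(3,1) that(1)] mult_left_mono[OF that(2) M(1)]
    by simp
  have "op_norm_H2 A \<le> M"
    unfolding op_norm_H2_def
    \<comment> \<open>The supremum is a conditional one over reals: the zero function shows that the
      unit ball is nonempty, and \<open>M\<close> supplies boundedness for \<open>cSUP_upper\<close>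
      below.\<close>
    by (rule cSUP_least) (use H2_zero le in \<open>auto simp: L2_norm_def intro!: exI[of _ "\<lambda>_. 0"]\<close>)
  moreover have "L2_norm (A f) \<le> op_norm_H2 A" if "f \<in> H2" "L2_norm f \<le> 1" for f
    unfolding op_norm_H2_def
    by (rule cSUP_upper) (use that le in \<open>auto intro!: bdd_aboveI2[of _ _ M]\<close>)
  then have "Linf_norm \<psi> \<le> ereal (op_norm_H2 A)"
    by (rule twisted_toeplitz_AE_bound[OF mu A psi])
  ultimately show ?thesis using M(2) by simp
qed

section \<open>Compactness and the theorem\<close>

text \<open>Beyond the degree of an approximating partial sum, the coefficients are those of the
  approximation error.\<close>

lemma fourier_coeff_small:
  assumes f: "f \<in> L2" and e: "e > 0"
  shows "\<exists>N. \<forall>n>N. cmod (fourier_coeff f n) < e"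
proof -
  let ?p = "\<lambda>N. trig_poly (fourier_coeff f) {-int N..int N}"
  obtain N where N: "L2_norm (\<lambda>z. ?p N z - f z) < e"
    using LIMSEQ_D[OF trig_poly_fourier_coeff_tendsto[OF f] e] L2_norm_nonneg by fastforce
  have "cmod (fourier_coeff f n) < e" if "n > int N" for n
  proof -
    have "cmod (fourier_coeff f n) = cmod (fourier_coeff (\<lambda>z. ?p N z - f z) n)"
      using that by (simp add: fourier_coeff_diff f L2_trig_poly fourier_coeff_trig_poly)
    also have "\<dots> \<le> L2_norm (\<lambda>z. ?p N z - f z)"
      by (intro cmod_fourier_coeff_le L2_diff L2_trig_poly f)
    finally show ?thesis using N by simp
  qed
  then show ?thesis by blast
qed

text \<open>Let the images of the basis vectors \<open>r n\<close> converge to \<open>g\<close>.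
  Their coefficients at \<open>r n + k\<close> have modulus \<open>c\<close>, yet approach those of
  \<open>g\<close> at indices tending to infinity, which tend to 0.\<close>

lemma compact_operator_diagonal:
  assumes A: "compact_operator_H2 A"
    and diag: "\<And>j. 0 \<le> j \<Longrightarrow> 0 \<le> j + k \<Longrightarrow> cmod (fourier_coeff (A (fourier_basis j)) (j + k)) = c"
  shows "c = 0"
proof -
  have bdd: "bounded_operator_H2 A" using A by (simp add: compact_operator_H2_def)
  have "\<exists>g\<in>H2. \<exists>r. strict_mono r \<and>
      (\<lambda>n. L2_norm (\<lambda>z. A (fourier_basis (int (r n))) z - g z)) \<longlonglongrightarrow> 0"
    using A unfolding compact_operator_H2_def
    by (elim conjE allE[of _ "\<lambda>n. fourier_basis (int n)"])
       (auto simp: H2_fourier_basis L2_norm_fourier_basis)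
  then obtain g r where g: "g \<in> H2" and r: "strict_mono r"
    and lim: "(\<lambda>n. L2_norm (\<lambda>z. A (fourier_basis (int (r n))) z - g z)) \<longlonglongrightarrow> 0"
    by blast
  have "c \<le> e + e" if e: "e > 0" for e
  proof -
    obtain N where N: "\<And>n. n > N \<Longrightarrow> cmod (fourier_coeff g n) < e"
      using fourier_coeff_small[OF H2_imp_L2[OF g] e] by blast
    obtain n0 where n0: "\<And>n. n \<ge> n0 \<Longrightarrow> L2_norm (\<lambda>z. A (fourier_basis (int (r n))) z - g z) < e"
      using LIMSEQ_D[OF lim e] L2_norm_nonneg by fastforce
    \<comment> \<open>As \<open>r n \<ge> n\<close>, the three entries ensure in turn an error below
      \<open>e\<close>, an index \<open>r n + k\<close> beyond \<open>N\<close>, and a nonnegative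
      index, as \<open>diag\<close> requires.\<close>
    define n where "n = Max {n0, nat (N - k + 1), nat (- k)}"
    have "n \<ge> n0" "n \<ge> nat (N - k + 1)" "n \<ge> nat (- k)" by (simp_all add: n_def)
    moreover have "r n \<ge> n" by (rule strict_mono_imp_increasing[OF r])
    ultimately have n: "n \<ge> n0" "int (r n) + k > N" "int (r n) + k \<ge> 0" by linarith+
    have AL: "A (fourier_basis (int (r n))) \<in> L2"
      by (rule H2_imp_L2[OF bounded_operator_H2_closed[OF bdd H2_fourier_basis]]) simp
    have "c = cmod (fourier_coeff (A (fourier_basis (int (r n)))) (int (r n) + k))"
      using n by (simp add: diag)
    also have "\<dots> \<le> cmod (fourier_coeff (\<lambda>z. A (fourier_basis (int (r n))) z - g z) (int (r n) + k))
        + cmod (fourier_coeff g (int (r n) + k))"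
      unfolding fourier_coeff_diff[OF AL H2_imp_L2[OF g]]
      by (metis diff_add_cancel norm_triangle_ineq)
    also have "\<dots> \<le> L2_norm (\<lambda>z. A (fourier_basis (int (r n))) z - g z) + e"
      by (intro add_mono cmod_fourier_coeff_le L2_diff AL H2_imp_L2 g less_imp_le[OF N] n)
    also have "\<dots> \<le> e + e" using n0[OF n(1)] by simp
    finally show ?thesis .
  qed
  \<comment> \<open>A positive \<open>c\<close> would satisfy \<open>c \<le> c / 2\<close>.\<close>
  from this[of "c / 4"] have "\<not> c > 0" by auto
  moreover have "0 \<le> c"
    using diag[of "\<bar>k\<bar>"] norm_ge_zero[of "fourier_coeff (A (fourier_basis \<bar>k\<bar>)) (\<bar>k\<bar> + k)"] by linarith
  ultimately show ?thesis by simp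
qed

lemma compact_operator_zero: "compact_operator_H2 (\<lambda>f z. 0)"
  unfolding compact_operator_H2_def bounded_operator_H2_def
proof (intro conjI allI impI)
  show "\<exists>g\<in>H2. \<exists>r :: nat \<Rightarrow> nat. strict_mono r \<and> (\<lambda>n. L2_norm (\<lambda>z. 0 - g z)) \<longlonglongrightarrow> 0"
    by (rule bexI[OF _ H2_zero], rule exI[of _ id]) (simp add: L2_norm_def strict_mono_def)
qed (auto simp: H2_zero L2_norm_def intro!: exI[of _ 0])

lemma matrix_compact_twisted_toeplitz_iff:
  assumes mu: "cmod \<mu> = 1"
  shows "matrix_compact (twisted_toeplitz \<mu> \<psi>) \<longleftrightarrow> (\<forall>n. fourier_coeff \<psi> n = 0)"
proof
  assume "matrix_compact (twisted_toeplitz \<mu> \<psi>)"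
  then obtain A where A: "compact_operator_H2 A" "has_matrix A (twisted_toeplitz \<mu> \<psi>)"
    by (auto simp: matrix_compact_def)
  have "cmod (fourier_coeff \<psi> k) = 0" for k
    by (rule compact_operator_diagonal[OF A(1), of k])
       (simp add: has_matrix_twisted_toeplitz[OF A(2)] norm_mult norm_power_int mu)
  then show "\<forall>n. fourier_coeff \<psi> n = 0" by simp
next
  assume "\<forall>n. fourier_coeff \<psi> n = 0"
  then show "matrix_compact (twisted_toeplitz \<mu> \<psi>)"
    unfolding matrix_compact_def
    by (intro exI[of _ "\<lambda>f z. 0"])
       (simp add: compact_operator_zero has_matrix_def twisted_toeplitz_def L2_inner_def)
qed

section \<open>Reduction of the theorem to twisted Toeplitz matrices\<close>

text \<open>Above the diagonal the minimum is already the row index \<open>i\<close>. On and below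
  it the minimum is \<open>j\<close>, and the missing power \<open>lam ^ (i - j)\<close> is
  compensated by the conjugate power in the coefficients of \<open>\<psi>\<close>.\<close>

lemma lambda_toeplitz_eq_twisted_toeplitz:
  assumes lam: "cmod lam = 1"
    and coeff: "\<And>n :: int. fourier_coeff \<psi> n =
      (if n \<ge> 0 then cnj lam powi n * fourier_coeff \<phi> n else fourier_coeff \<phi> n)"
  shows "lambda_toeplitz lam \<phi> = twisted_toeplitz lam \<psi>"
proof (intro ext)
  fix i j
  show "lambda_toeplitz lam \<phi> i j = twisted_toeplitz lam \<psi> i j"
  proof (cases "j \<le> i")
    case True
    then obtain d where d: "i = j + d" using le_Suc_ex by blast
    have "lam ^ d * cnj lam ^ d = 1"
      using lam by (simp add: complex_norm_square[symmetric] flip: power_mult_distrib)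
    then show ?thesis
      by (simp add: d lambda_toeplitz_def twisted_toeplitz_def coeff power_add min_def)
  next
    case False
    then show ?thesis
      by (simp add: lambda_toeplitz_def twisted_toeplitz_def coeff)
  qed
qed

lemma toeplitz_eq_twisted_toeplitz: "toeplitz \<psi> = twisted_toeplitz 1 \<psi>"
  by (simp add: fun_eq_iff toeplitz_def twisted_toeplitz_def)

theorem proposition2p1:
  fixes lam :: complex and \<phi> \<psi> :: "complex \<Rightarrow> complex"
  assumes lam: "cmod lam = 1"
    and phi: "\<phi> \<in> L2"
    and psi: "\<psi> \<in> L2"
    and psi_coeff: "\<And>n :: int. fourier_coeff \<psi> n =
          (if n \<ge> 0 then cnj lam powi n * fourier_coeff \<phi> n else fourier_coeff \<phi> n)"
  shows "(matrix_bounded (lambda_toeplitz lam \<phi>) \<longleftrightarrow> matrix_bounded (toeplitz \<psi>)) \<and>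
         (matrix_bounded (toeplitz \<psi>) \<longleftrightarrow> \<psi> \<in> Linf) \<and>
         (\<forall>A. bounded_operator_H2 A \<and> has_matrix A (lambda_toeplitz lam \<phi>) \<longrightarrow>
              ereal (op_norm_H2 A) = Linf_norm \<psi>) \<and>
         (matrix_compact (lambda_toeplitz lam \<phi>) \<longleftrightarrow> (AE z in circle. \<psi> z = 0)) \<and>
         (matrix_compact (lambda_toeplitz lam \<phi>) \<longleftrightarrow> (AE z in circle. \<phi> z = 0))"
proof -
  have "lam \<noteq> 0" using lam by auto
  \<comment> \<open>The coefficients differ by nonzero factors, so \<open>\<phi>\<close> and
    \<open>\<psi>\<close> vanish together.\<close>
  then have coeff_0: "fourier_coeff \<psi> n = 0 \<longleftrightarrow> fourier_coeff \<phi> n = 0" for n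
    by (simp add: psi_coeff)
  \<comment> \<open>The boundedness criterion is used with twist \<open>lam\<close> for the first
    matrix and twist 1 for the Toeplitz matrix; both come down to
    \<open>\<psi> \<in> Linf\<close>.\<close>
  show ?thesis
    unfolding lambda_toeplitz_eq_twisted_toeplitz[OF lam psi_coeff] toeplitz_eq_twisted_toeplitz
      AE_eq_0_iff_fourier_coeff[OF psi] AE_eq_0_iff_fourier_coeff[OF phi]
    using op_norm_twisted_toeplitz[OF lam psi]
    by (simp add: matrix_bounded_twisted_toeplitz_iff matrix_compact_twisted_toeplitz_iff lam psi coeff_0)
qed

end
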